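(* Let $(X_i)_{i\ge 1}$ be a sequence of i.i.d. real valued random variables with distribution function $F$ and variance $\sigma^2$. Suppose that $X_1$ is a non-lattice, discrete random variable. Suppose furthermore that $\beta_3=E[|X_1|^3]<\infty$ and let $\alpha\in\left(\frac23,1\right)$. If $k=k_n$ satisfies $k\sim n^{\alpha}$ as $n\to\infty$, then $$F_+\left(\frac{\sqrt{k}\,\sigma x}{n}\right)-F_-\left(\frac{\sqrt{k}\,\sigma x}{n}\right)=\frac{x e^{-x^2/2}}{\sqrt{2\pi}}\,\frac{k}{n}+o\left(\frac{k}{n}\right)$$ as $n\to\infty$, uniformly in $x\in\mathbb{R}$.
   Context: For $n\ge1$ let $Y_n=\frac1n\sum_{i=1}^n X_i$ be the sample mean of the first $n$ variables. For integers $1\le k<n$ set $\Delta_{n,+k}=Y_{n+k}-Y_n$ and $\Delta_{n,-k}=Y_n-Y_{n-k}$. $F_+$ and $F_-$ denote the distribution functions of $\Delta_{n,+k}$ and $\Delta_{n,-k}$ respectively (they depend on $n$ and $k$). Here $k=k_n$ is a sequence of positive integers, $k\sim n^\alpha$ means $k_n/n^\alpha\to1$, and "uniformly in $x$" means that the supremum over $x\in\mathbb{R}$ of the absolute value of the remainder is $o(k/n)$. A random variable is discrete if it takes values in a countable set almost surely; it is lattice if there are reals $a,h$ with $P(X\in a+h\mathbb{Z})=1$ (in particular constants are lattice), and non-lattice otherwise. *)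

theory Defs
  imports "HOL-Probability.Probability" "HOL-Library.Landau_Symbols"
begin

text \<open>Sequences of random variables are indexed by \<open>1, 2, 3, \<dots>\<close>; the value at index 0 is never used.\<close>

definition sample_mean :: "(nat \<Rightarrow> 'a \<Rightarrow> real) \<Rightarrow> nat \<Rightarrow> 'a \<Rightarrow> real" where
  "sample_mean X n \<omega> = (1 / real n) * (\<Sum>i = 1..n. X i \<omega>)"

definition delta_plus :: "(nat \<Rightarrow> 'a \<Rightarrow> real) \<Rightarrow> nat \<Rightarrow> nat \<Rightarrow> 'a \<Rightarrow> real" where
  "delta_plus X n k \<omega> = sample_mean X (n + k) \<omega> - sample_mean X n \<omega>"

text \<open>Only meaningful for \<open>1 \<le> k < n\<close>; the subtraction \<open>n - k\<close> truncates otherwise.\<close>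

definition delta_minus :: "(nat \<Rightarrow> 'a \<Rightarrow> real) \<Rightarrow> nat \<Rightarrow> nat \<Rightarrow> 'a \<Rightarrow> real" where
  "delta_minus X n k \<omega> = sample_mean X n \<omega> - sample_mean X (n - k) \<omega>"

definition F_plus :: "'a measure \<Rightarrow> (nat \<Rightarrow> 'a \<Rightarrow> real) \<Rightarrow> nat \<Rightarrow> nat \<Rightarrow> real \<Rightarrow> real" where
  "F_plus M X n k = cdf (distr M borel (delta_plus X n k))"

definition F_minus :: "'a measure \<Rightarrow> (nat \<Rightarrow> 'a \<Rightarrow> real) \<Rightarrow> nat \<Rightarrow> nat \<Rightarrow> real \<Rightarrow> real" where
  "F_minus M X n k = cdf (distr M borel (delta_minus X n k))"

definition discrete_rv :: "'a measure \<Rightarrow> ('a \<Rightarrow> real) \<Rightarrow> bool" where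
  "discrete_rv M Z \<longleftrightarrow> (\<exists>C. countable C \<and> (AE \<omega> in M. Z \<omega> \<in> C))"

text \<open>The span \<open>h = 0\<close> is allowed, so almost surely constant variables are lattice.\<close>

definition lattice_rv :: "'a measure \<Rightarrow> ('a \<Rightarrow> real) \<Rightarrow> bool" where
  "lattice_rv M Z \<longleftrightarrow>
     (\<exists>a h :: real. \<P>(\<omega> in M. Z \<omega> \<in> range (\<lambda>m :: int. a + h * real_of_int m)) = 1)"

end

theory Submission
  imports Defs "HOL-Real_Asymp.Real_Asymp"
begin

text \<open>
  Since \<open>\<alpha> > 2/3\<close>, one has \<open>1 / sqrt k = o(k / n)\<close> with a polynomial margin, so normal
  approximation of both differences with the Berry--Esseen rate, even up to logarithms, is enough
  (and \<open>\<sigma> > 0\<close> since constants are lattice). Both differences are weighted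
  sums of independent variables consisting of two blocks, and \<open>\<Delta>\<^sub>-\<close> for \<open>n\<close> is
  \<open>\<Delta>\<^sub>+\<close> for \<open>n - k\<close>. Their variances, \<open>\<sigma>\<^sup>2 k / (n (n + k))\<close>
  and \<open>\<sigma>\<^sup>2 k / (n (n - k))\<close>, differ slightly, and the main term is the resulting
  \<open>\<Phi> (x sqrt (1 + k/n)) - \<Phi> (x sqrt (1 - k/n))\<close>.

  The normal approximation is obtained by smoothing with a Gaussian of width \<open>\<epsilon>\<close> and
  Levy inversion. As the Gaussian damping is not compactly supported, \<open>\<epsilon>\<close> must exceed
  \<open>1 / sqrt k\<close> by a factor \<open>l\<close> (eventually \<open>ln n\<close>), which costs the logarithms.
\<close>

section \<open>Distribution functions and characteristic functions\<close>

text \<open>The majorant is integrated over the whole line, so the bound does not depend on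
  \<open>T\<close> and survives the limit in the inversion formula.\<close>

lemma norm_CLBINT_le:
  fixes f :: "real \<Rightarrow> complex" and g :: "real \<Rightarrow> real"
  assumes g: "integrable lborel g" and "T \<ge> 0" and le: "\<And>t. norm (f t) \<le> g t"
  shows "norm (CLBINT t=ereal (-T)..ereal T. f t) \<le> (LBINT t. g t)"
proof -
  have g0: "0 \<le> g t" for t using le[of t] norm_ge_zero order_trans by blast
  have "norm (CLBINT t=ereal (-T)..ereal T. f t) = norm (LINT t|lborel. indicator {-T<..<T} t *\<^sub>R f t)"
    using \<open>T \<ge> 0\<close> by (simp add: interval_lebesgue_integral_def set_lebesgue_integral_def einterval_eq)
  also have "\<dots> \<le> (LBINT t. norm (indicator {-T<..<T} t *\<^sub>R f t))"
    by (rule integral_norm_bound)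
  also have "\<dots> \<le> (LBINT t. g t)"
    by (rule integral_mono'[OF g]) (auto split: split_indicator simp: le g0)
  finally show ?thesis .
qed

text \<open>Unlike the bound by \<open>\<bar>b - a\<bar>\<close>, this one is free of
  \<open>a\<close> and \<open>b\<close>, which later allows \<open>a\<close> to go to minus
  infinity. At \<open>t = 0\<close> both sides are 0 by the convention for division.\<close>

lemma norm_iexp_diff_quotient_le:
  "norm ((iexp (-(t * a)) - iexp (-(t * b))) / (\<i> * complex_of_real t)) \<le> 2 / \<bar>t\<bar>"
proof -
  have "norm (iexp (-(t * a)) - iexp (-(t * b))) \<le> norm (iexp (-(t * a))) + norm (iexp (-(t * b)))"
    by (rule norm_triangle_ineq4)
  also have "\<dots> = 2" using norm_exp_i_times[of "-(t*a)"] norm_exp_i_times[of "-(t*b)"] by simp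
  finally show ?thesis by (simp add: norm_divide norm_mult divide_right_mono)
qed

text \<open>On a bounded interval it suffices that the kernel is bounded by
  \<open>\<bar>b - a\<bar>\<close> and the characteristic function by 1. This permits subtracting
  two truncated inversion integrals under one integral sign.\<close>

lemma interval_integrable_inversion_kernel:
  assumes "real_distribution M"
  shows "interval_lebesgue_integrable lborel (ereal (-T)) (ereal T)
    (\<lambda>t. (iexp (-(t * a)) - iexp (-(t * b))) / (\<i> * complex_of_real t) * char M t)"
proof -
  interpret real_distribution M by fact
  have bd: "norm ((iexp (-(t * a)) - iexp (-(t * b))) / (\<i> * complex_of_real t) * char M t) \<le> \<bar>b - a\<bar>" for t
  proof -
    have *: "norm ((iexp (-(t * a)) - iexp (-(t * b))) / (\<i> * complex_of_real t)) \<le> \<bar>b - a\<bar>"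
    proof (cases "t = 0")
      case False
      show ?thesis
      proof (cases "a \<le> b")
        case True
        then show ?thesis using Levy_Inversion_aux2[of "-b" "-a" t] False by simp
      next
        case *: False
        then show ?thesis using Levy_Inversion_aux2[of "-a" "-b" t] False
          by (simp add: norm_divide norm_minus_commute)
      qed
    qed auto
    show ?thesis unfolding norm_mult
      using mult_mono[OF * cmod_char_le_1[of t]] by auto
  qed
  have fin: "emeasure lborel {u<..<v} < \<infinity>" for u v :: real
    by (rule emeasure_bounded_finite) simp
  have "set_integrable lborel {u<..<v} (\<lambda>t. (iexp (-(t * a)) - iexp (-(t * b))) / (\<i> * complex_of_real t) * char M t)" for u v
    unfolding set_integrable_def
    by (rule integrableI_bounded_set_indicator[where B="\<bar>b - a\<bar>"])
       (use bd in \<open>auto simp: fin[simplified] simp del: of_real_mult times_divide_eq_left\<close>)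
  then show ?thesis
    by (simp add: interval_lebesgue_integrable_def einterval_eq)
qed

text \<open>Levy inversion is applied to both measures, which is why the endpoints must not be
  atoms. The factor \<open>\<bar>t\<bar>\<close> in the hypothesis cancels the singularity
  \<open>2 / \<bar>t\<bar>\<close> of the kernel, leaving \<open>2 * g t\<close>; the prefactor
  \<open>1 / (2 * pi)\<close> turns this into the stated bound.\<close>

lemma measure_Ioc_diff_le_char:
  fixes g :: "real \<Rightarrow> real"
  assumes M: "real_distribution M" and N: "real_distribution N"
    and g: "integrable lborel g" and g0: "\<And>t. 0 \<le> g t"
    and le: "\<And>t. norm (char M t - char N t) \<le> \<bar>t\<bar> * g t"
    and ab: "a \<le> b" "measure M {a} = 0" "measure M {b} = 0" "measure N {a} = 0" "measure N {b} = 0"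
  shows "\<bar>measure M {a<..b} - measure N {a<..b}\<bar> \<le> (LBINT t. g t) / pi"
proof -
  define K where "K t = (iexp (-(t * a)) - iexp (-(t * b))) / (\<i> * complex_of_real t)" for t
  let ?I = "\<lambda>M (T::nat). 1 / (2 * pi) * (CLBINT t=ereal (- real T)..ereal (real T). K t * char M t)"
  have M_lim: "?I M \<longlonglongrightarrow> measure M {a<..b}" and N_lim: "?I N \<longlonglongrightarrow> measure N {a<..b}"
    using real_distribution.Levy_Inversion[OF M] real_distribution.Levy_Inversion[OF N] ab
    unfolding K_def by simp_all
  have "norm (complex_of_real (measure M {a<..b}) - complex_of_real (measure N {a<..b})) \<le> (LBINT t. g t) / pi"
  proof (rule tendsto_upperbound)
    show "(\<lambda>T. norm (?I M T - ?I N T)) \<longlonglongrightarrow>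
        norm (complex_of_real (measure M {a<..b}) - complex_of_real (measure N {a<..b}))"
      by (intro tendsto_intros M_lim N_lim)
    have "norm (?I M T - ?I N T) \<le> (LBINT t. g t) / pi" for T
    proof -
      have ii: "interval_lebesgue_integrable lborel (ereal (- real T)) (ereal (real T)) (\<lambda>t. K t * char M t)"
        "interval_lebesgue_integrable lborel (ereal (- real T)) (ereal (real T)) (\<lambda>t. K t * char N t)"
        unfolding K_def using interval_integrable_inversion_kernel[OF M] interval_integrable_inversion_kernel[OF N] by blast+
      have eq: "?I M T - ?I N T = 1 / (2 * pi) *
          (CLBINT t=ereal (- real T)..ereal (real T). K t * char M t - K t * char N t)"
        by (subst interval_lebesgue_integral_diff(2)[OF ii]) (simp add: right_diff_distrib diff_divide_distrib)
      have bd: "norm (CLBINT t=ereal (- real T)..ereal (real T). K t * char M t - K t * char N t) \<le> (LBINT t. 2 * g t)"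
      proof (rule norm_CLBINT_le)
        fix t
        have "norm (K t * char M t - K t * char N t) = norm (K t) * norm (char M t - char N t)"
          by (simp add: right_diff_distrib flip: norm_mult)
        also have "\<dots> \<le> 2 / \<bar>t\<bar> * (\<bar>t\<bar> * g t)"
          unfolding K_def by (intro mult_mono norm_iexp_diff_quotient_le le) (auto simp: g0)
        also have "\<dots> \<le> 2 * g t" using g0[of t] by (cases "t = 0") auto
        finally show "norm (K t * char M t - K t * char N t) \<le> 2 * g t" .
      qed (use g in auto)
      have "norm (?I M T - ?I N T) = norm (CLBINT t=ereal (- real T)..ereal (real T). K t * char M t - K t * char N t) / (2 * pi)"
        unfolding eq by (simp add: norm_mult norm_divide)
      also have "\<dots> \<le> (LBINT t. 2 * g t) / (2 * pi)"
        by (rule divide_right_mono[OF bd]) simp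
      finally show ?thesis by simp
    qed
    then show "\<forall>\<^sub>F T in sequentially. norm (?I M T - ?I N T) \<le> (LBINT t. g t) / pi"
      by simp
  qed simp
  then show ?thesis
    by (metis norm_of_real of_real_diff real_norm_def)
qed

text \<open>Let \<open>a\<close> go to minus infinity and \<open>b\<close> decrease to
  \<open>x\<close>, both through points that are atoms of neither measure. Such points exist in
  every nonempty open set because there are only countably many atoms, and right continuity recovers
  the value at \<open>x\<close> itself.\<close>

lemma cdf_diff_le_char:
  fixes g :: "real \<Rightarrow> real"
  assumes M: "real_distribution M" and N: "real_distribution N"
    and g: "integrable lborel g" and g0: "\<And>t. 0 \<le> g t"
    and le: "\<And>t. norm (char M t - char N t) \<le> \<bar>t\<bar> * g t"
  shows "\<bar>cdf M x - cdf N x\<bar> \<le> (LBINT t. g t) / pi"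
proof (rule field_le_epsilon)
  interpret M: real_distribution M by fact
  interpret N: real_distribution N by fact
  define d where "d x = cdf M x - cdf N x" for x
  have "countable ({x. measure M {x} \<noteq> 0} \<union> {x. measure N {x} \<noteq> 0})"
    by (intro countable_Un M.countable_support N.countable_support)
  then have count: "countable {x. measure M {x} \<noteq> 0 \<or> measure N {x} \<noteq> 0}"
    by (simp add: Un_def)
  fix e :: real assume "e > 0"
  have "(d \<longlongrightarrow> 0 - 0) at_bot"
    unfolding d_def by (intro tendsto_diff M.cdf_lim_at_bot N.cdf_lim_at_bot)
  then have "eventually (\<lambda>y. \<bar>d y\<bar> < e / 2) at_bot"
    using \<open>e > 0\<close> by (auto dest!: tendstoD[where e="e/2"] simp: dist_real_def)
  then obtain m where m: "\<And>y. y \<le> m \<Longrightarrow> \<bar>d y\<bar> < e / 2"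
    unfolding eventually_at_bot_linorder by auto
  obtain a where a: "measure M {a} = 0" "measure N {a} = 0" "a < min m x"
    using open_minus_countable[OF count, of "{..< min m x}"] by auto
  have "(d \<longlongrightarrow> d x) (at_right x)"
    using M.cdf_is_right_cont[of x] N.cdf_is_right_cont[of x]
    unfolding d_def by (intro tendsto_intros) (auto simp add: continuous_within)
  then have "eventually (\<lambda>y. \<bar>d y - d x\<bar> < e / 2) (at_right x)"
    using \<open>e > 0\<close> by (auto dest!: tendstoD[where e="e/2"] simp: dist_real_def)
  then obtain n where n: "n > x" "\<And>y. x < y \<Longrightarrow> y < n \<Longrightarrow> \<bar>d y - d x\<bar> < e / 2"
    by (auto simp add: eventually_at_right[OF less_add_one])
  obtain b where b: "x < b" "b < n" "measure M {b} = 0" "measure N {b} = 0"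
    using open_minus_countable[OF count, of "{x <..< n}"] n by auto
  have "a < b" using a b by linarith
  have "\<bar>measure M {a<..b} - measure N {a<..b}\<bar> \<le> (LBINT t. g t) / pi"
    by (rule measure_Ioc_diff_le_char[OF M N g g0 le]) (use a b \<open>a < b\<close> in auto)
  then have "\<bar>d b - d a\<bar> \<le> (LBINT t. g t) / pi"
    unfolding d_def M.cdf_diff_eq[OF \<open>a < b\<close>, symmetric] N.cdf_diff_eq[OF \<open>a < b\<close>, symmetric]
    by (simp add: algebra_simps)
  moreover have "\<bar>d a\<bar> < e / 2" "\<bar>d b - d x\<bar> < e / 2"
    using m[of a] n(2)[of b] a b by auto
  ultimately have "\<bar>d x\<bar> \<le> (LBINT t. g t) / pi + e" by linarith
  then show "\<bar>cdf M x - cdf N x\<bar> \<le> (LBINT t. g t) / pi + e" by (simp add: d_def)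
qed

section \<open>Smoothing by convolution\<close>

lemma real_distribution_convolution:
  assumes "real_distribution M" "real_distribution N"
  shows "real_distribution (M \<star> N)"
proof -
  interpret M: real_distribution M by fact
  interpret N: real_distribution N by fact
  interpret P: pair_prob_space M N ..
  show ?thesis unfolding convolution_def
    by (intro P.real_distribution_distr) measurable
qed

lemma char_convolution:
  assumes "real_distribution M" "real_distribution N"
  shows "char (M \<star> N) t = char M t * char N t"
proof -
  interpret M: real_distribution M by fact
  interpret N: real_distribution N by fact
  interpret P: pair_prob_space M N ..
  have i: "integrable (M \<Otimes>\<^sub>M N) (\<lambda>p. iexp (t * (fst p + snd p)))"
    by (rule P.integrable_const_bound[where B=1]) auto
  have "char (M \<star> N) t = (CLINT p|(M \<Otimes>\<^sub>M N). iexp (t * (fst p + snd p)))"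
    unfolding char_def convolution_def
    by (subst integral_distr) (auto simp: case_prod_beta)
  also have "\<dots> = (CLINT x|M. CLINT y|N. iexp (t * (x + y)))"
    using P.integral_fst'[OF i] by simp
  also have "\<dots> = (CLINT x|M. iexp (t * x) * char N t)"
    unfolding char_def by (subst integral_mult_right_zero[symmetric]) (simp add: algebra_simps exp_add)
  also have "\<dots> = char M t * char N t"
    unfolding char_def by simp
  finally show ?thesis .
qed

text \<open>For independent U and V with laws \<open>M\<close> and \<open>N\<close>: if U is at most
  \<open>x\<close> and V at most \<open>c\<close>, then U + V is at most \<open>x + c\<close>; if U
  + V is at most \<open>x - c\<close> and V at least \<open>-c\<close>, then U is at most
  \<open>x\<close>. The exceptional events for V give the tail terms.\<close>

lemma cdf_convolution_shift:
  assumes "real_distribution M" "real_distribution N"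
  shows "cdf M x \<le> cdf (M \<star> N) (x + c) + measure N {c<..}"
    and "cdf (M \<star> N) (x - c) \<le> cdf M x + measure N {..<-c}"
proof -
  interpret M: real_distribution M by fact
  interpret N: real_distribution N by fact
  interpret P: pair_prob_space M N ..
  have M1: "measure M UNIV = 1" "measure N UNIV = 1"
    using M.prob_space N.prob_space by simp_all
  have sM: "P.prob {p. fst p \<le> x} = cdf M x" for x
  proof -
    have "{p::real\<times>real. fst p \<le> x} = {..x} \<times> UNIV" by auto
    then show ?thesis by (simp add: measure_def N.emeasure_pair_measure_Times enn2real_mult M1[unfolded measure_def] cdf_def)
  qed
  have sN: "P.prob {p. snd p \<in> A} = measure N A" if "A \<in> sets borel" for A
  proof -
    have "{p::real\<times>real. snd p \<in> A} = UNIV \<times> A" by auto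
    then show ?thesis using that by (simp add: measure_def N.emeasure_pair_measure_Times enn2real_mult M1[unfolded measure_def])
  qed
  have sC: "cdf (M \<star> N) y = P.prob {p. fst p + snd p \<le> y}" for y
    unfolding cdf_def convolution_def
    by (subst measure_distr) (auto simp: case_prod_beta vimage_def space_pair_measure)
  have sp: "space (M \<Otimes>\<^sub>M N) = UNIV" by (simp add: space_pair_measure)
  have "{p \<in> space (M \<Otimes>\<^sub>M N). fst p \<le> y} \<in> sets (M \<Otimes>\<^sub>M N)"
    "{p \<in> space (M \<Otimes>\<^sub>M N). fst p + snd p \<le> y} \<in> sets (M \<Otimes>\<^sub>M N)" for y
    by measurable
  moreover have "{p \<in> space (M \<Otimes>\<^sub>M N). snd p \<in> A} \<in> sets (M \<Otimes>\<^sub>M N)" if [measurable]: "A \<in> sets borel" for A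
    by measurable
  ultimately have m: "{p. fst p \<le> y} \<in> sets (M \<Otimes>\<^sub>M N)" "{p. fst p + snd p \<le> y} \<in> sets (M \<Otimes>\<^sub>M N)"
     "A \<in> sets borel \<Longrightarrow> {p. snd p \<in> A} \<in> sets (M \<Otimes>\<^sub>M N)" for y A
    unfolding sp by auto
  have "cdf M x \<le> P.prob ({p. fst p + snd p \<le> x + c} \<union> {p. snd p \<in> {c<..}})"
    unfolding sM[symmetric] by (intro P.finite_measure_mono sets.Un m) auto
  also have "\<dots> \<le> cdf (M \<star> N) (x + c) + measure N {c<..}"
    unfolding sC by (subst sN[symmetric], simp, intro measure_Un_le m) auto
  finally show "cdf M x \<le> cdf (M \<star> N) (x + c) + measure N {c<..}" .
  have "cdf (M \<star> N) (x - c) \<le> P.prob ({p. fst p \<le> x} \<union> {p. snd p \<in> {..<-c}})"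
    unfolding sC by (intro P.finite_measure_mono sets.Un m) auto
  also have "\<dots> \<le> cdf M x + measure N {..<-c}"
    unfolding sM[symmetric] by (subst sN[symmetric], simp, intro measure_Un_le m) auto
  finally show "cdf (M \<star> N) (x - c) \<le> cdf M x + measure N {..<-c}" .
qed

text \<open>For the upper bound, go from \<open>M\<close> at \<open>x\<close> to
  \<open>M \<star> N\<close> at \<open>x + c\<close>, across to \<open>G \<star> N\<close> at the
  cost \<open>D\<close>, and back to \<open>G\<close> at \<open>x + 2 * c\<close>. Each passage
  costs a tail \<open>q\<close>, and the Lipschitz bound absorbs the displacement
  \<open>2 * c\<close>. The lower bound is the mirror image.\<close>

lemma cdf_diff_le_smoothing:
  assumes M: "real_distribution M" and G: "real_distribution G" and N: "real_distribution N"
    and lip: "\<And>x y. x \<le> y \<Longrightarrow> cdf G y - cdf G x \<le> m * (y - x)"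
    and D: "\<And>x. \<bar>cdf (M \<star> N) x - cdf (G \<star> N) x\<bar> \<le> D"
    and q: "measure N {c<..} \<le> q" "measure N {..<-c} \<le> q" and "c \<ge> 0"
  shows "\<bar>cdf M x - cdf G x\<bar> \<le> D + 2 * m * c + 2 * q"
proof -
  have "cdf M x \<le> cdf (M \<star> N) (x + c) + q"
    using cdf_convolution_shift(1)[OF M N, of x c] q by linarith
  moreover have "cdf (G \<star> N) (x + c) \<le> cdf G (x + 2 * c) + q"
    using cdf_convolution_shift(2)[OF G N, of "x + 2 * c" c] q by (simp add: algebra_simps)
  moreover have "cdf G (x + 2 * c) - cdf G x \<le> m * (2 * c)"
    using lip[of x "x + 2 * c"] \<open>c \<ge> 0\<close> by simp
  moreover have "cdf (M \<star> N) (x - c) \<le> cdf M x + q"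
    using cdf_convolution_shift(2)[OF M N, of x c] q by linarith
  moreover have "cdf G (x - 2 * c) \<le> cdf (G \<star> N) (x - c) + q"
    using cdf_convolution_shift(1)[OF G N, of "x - 2 * c" c] q by (simp add: algebra_simps)
  moreover have "cdf G x - cdf G (x - 2 * c) \<le> m * (2 * c)"
    using lip[of "x - 2 * c" x] \<open>c \<ge> 0\<close> by simp
  moreover note D[of "x + c"] D[of "x - c"]
  ultimately show ?thesis by (simp add: abs_le_iff)
qed

section \<open>Characteristic functions near the origin\<close>

lemma abs_exp_minus_taylor_le:
  fixes y :: real assumes "y \<ge> 0"
  shows "\<bar>1 - y - exp (-y)\<bar> \<le> y" "\<bar>1 - y - exp (-y)\<bar> \<le> y\<^sup>2 / 2"
proof -
  have ge: "1 - y \<le> exp (-y)" using exp_ge_add_one_self[of "-y"] by simp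
  moreover have "exp (-y) \<le> 1" using assms by simp
  ultimately show "\<bar>1 - y - exp (-y)\<bar> \<le> y" by linarith
  have "exp (-y) \<le> 1 - y + y\<^sup>2 / 2"
  proof -
    have "1 - 0 + 0\<^sup>2 / 2 - exp (-0) \<le> 1 - y + y\<^sup>2 / 2 - exp (-y)"
    proof (rule DERIV_nonneg_imp_nondecreasing[OF assms])
      fix x :: real
      have "((\<lambda>y. 1 - y + y\<^sup>2 / 2 - exp (-y)) has_real_derivative (-1 + x + exp (-x))) (at x)"
        by (auto intro!: derivative_eq_intros)
      moreover have "-1 + x + exp (-x) \<ge> 0" using exp_ge_add_one_self[of "-x"] by simp
      ultimately show "\<exists>z. ((\<lambda>y. 1 - y + y\<^sup>2 / 2 - exp (-y)) has_real_derivative z) (at x) \<and> 0 \<le> z" by blast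
    qed
    then show ?thesis by simp
  qed
  with ge show "\<bar>1 - y - exp (-y)\<bar> \<le> y\<^sup>2 / 2" by simp
qed

text \<open>For small \<open>u\<close> the error is of fourth order, for large \<open>u\<close> of
  second order; a cubic dominates both when the cases are split at
  \<open>\<bar>u\<bar> = 1\<close>.\<close>

lemma abs_exp_minus_taylor_cube_le:
  fixes u :: real
  shows "\<bar>1 - u\<^sup>2 / 2 - exp (- u\<^sup>2 / 2)\<bar> \<le> \<bar>u\<bar> ^ 3"
proof (cases "\<bar>u\<bar> \<le> 1")
  case True
  have "\<bar>1 - u\<^sup>2 / 2 - exp (- u\<^sup>2 / 2)\<bar> \<le> (u\<^sup>2 / 2)\<^sup>2 / 2"
    using abs_exp_minus_taylor_le(2)[of "u\<^sup>2 / 2"] by simp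
  also have "\<dots> = \<bar>u\<bar> ^ 3 * (\<bar>u\<bar> / 8)"
    by (simp add: power2_eq_square power3_eq_cube abs_mult_self_eq)
  also have "\<dots> \<le> \<bar>u\<bar> ^ 3 * 1" using True by (intro mult_left_mono) auto
  finally show ?thesis by simp
next
  case False
  have "\<bar>1 - u\<^sup>2 / 2 - exp (- u\<^sup>2 / 2)\<bar> \<le> u\<^sup>2 / 2"
    using abs_exp_minus_taylor_le(1)[of "u\<^sup>2 / 2"] by simp
  also have "\<dots> \<le> \<bar>u\<bar>\<^sup>2 * 1" by simp
  also have "\<dots> \<le> \<bar>u\<bar>\<^sup>2 * \<bar>u\<bar>" using False by (intro mult_left_mono) auto
  finally show ?thesis by (simp add: power2_eq_square power3_eq_cube)
qed

lemma abs_power_le_one_plus_cube: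
  fixes x :: real assumes "n \<le> 3"
  shows "\<bar>x\<bar> ^ n \<le> 1 + \<bar>x\<bar> ^ 3"
proof (cases "\<bar>x\<bar> \<le> 1")
  case True
  then have "\<bar>x\<bar> ^ n \<le> 1" by (intro power_le_one) auto
  moreover have "0 \<le> \<bar>x\<bar> ^ 3" by simp
  ultimately show ?thesis by linarith
next
  case False
  then have "\<bar>x\<bar> ^ n \<le> \<bar>x\<bar> ^ 3" using assms by (intro power_increasing) auto
  then show ?thesis by simp
qed

text \<open>Lower moments are dominated by \<open>1 + \<bar>X \<omega>\<bar> ^ 3\<close>; the third
  claim carries the moment assumption over to the standardized variable.\<close>

lemma (in prob_space) integrable_of_third_moment:
  fixes X :: "'a \<Rightarrow> real"
  assumes [measurable]: "random_variable borel X" and "integrable M (\<lambda>\<omega>. \<bar>X \<omega>\<bar> ^ 3)"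
  shows "integrable M X" and "integrable M (\<lambda>\<omega>. (X \<omega>)\<^sup>2)" and "integrable M (\<lambda>\<omega>. \<bar>(X \<omega> - m) / s\<bar> ^ 3)"
proof -
  have i: "integrable M (\<lambda>\<omega>. 1 + \<bar>X \<omega>\<bar> ^ 3)" using assms by simp
  show "integrable M X"
    by (rule Bochner_Integration.integrable_bound[OF i])
      (use abs_power_le_one_plus_cube[of 1] in \<open>auto intro!: AE_I2\<close>)
  show "integrable M (\<lambda>\<omega>. (X \<omega>)\<^sup>2)"
    by (rule Bochner_Integration.integrable_bound[OF i])
      (use abs_power_le_one_plus_cube[of 2] in \<open>auto intro!: AE_I2\<close>)
  have le: "\<bar>x - m\<bar> ^ 3 \<le> 8 * (\<bar>x\<bar> ^ 3 + \<bar>m\<bar> ^ 3)" for x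
  proof -
    have "\<bar>x - m\<bar> ^ 3 \<le> (2 * max \<bar>x\<bar> \<bar>m\<bar>) ^ 3" by (intro power_mono) auto
    also have "\<dots> = 8 * max \<bar>x\<bar> \<bar>m\<bar> ^ 3" by (simp add: power_mult_distrib)
    also have "\<dots> \<le> 8 * (\<bar>x\<bar> ^ 3 + \<bar>m\<bar> ^ 3)" by (auto simp: max_def)
    finally show ?thesis .
  qed
  have "integrable M (\<lambda>\<omega>. 8 * (\<bar>X \<omega>\<bar> ^ 3 + \<bar>m\<bar> ^ 3))" using assms by simp
  then have "integrable M (\<lambda>\<omega>. \<bar>X \<omega> - m\<bar> ^ 3)"
    by (rule Bochner_Integration.integrable_bound) (use le in \<open>auto intro!: AE_I2\<close>)
  then show "integrable M (\<lambda>\<omega>. \<bar>(X \<omega> - m) / s\<bar> ^ 3)"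
    by (simp add: power_divide)
qed

text \<open>Both the characteristic function and the Gaussian are compared with
  \<open>1 - u\<^sup>2 / 2\<close>, with errors \<open>\<beta> / 6 * \<bar>u\<bar> ^ 3\<close> and
  \<open>\<bar>u\<bar> ^ 3\<close>, hence \<open>B = \<beta> / 6 + 1\<close>. The last claim gives
  Gaussian decay on the window where the cubic error is at most half of the quadratic term.\<close>

lemma (in real_distribution) char_gaussian_approx:
  assumes mean: "expectation (\<lambda>x. x) = 0" and var: "expectation (\<lambda>x. x\<^sup>2) = 1"
    and third: "integrable M (\<lambda>x. \<bar>x\<bar> ^ 3)"
  obtains B :: real where "B \<ge> 1"
    and "\<And>u. norm (char M u - exp (- u\<^sup>2 / 2)) \<le> B * \<bar>u\<bar> ^ 3"
    and "\<And>u. B * \<bar>u\<bar> \<le> 1 / 4 \<Longrightarrow> norm (char M u) \<le> exp (- u\<^sup>2 / 4)"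
proof -
  define \<beta> where "\<beta> = expectation (\<lambda>x. \<bar>x\<bar> ^ 3)"
  have "\<beta> \<ge> 0" unfolding \<beta>_def by (rule integral_nonneg_AE) auto
  have i1: "integrable M (\<lambda>x. x)" and i2: "integrable M (\<lambda>x. x\<^sup>2)"
    by (simp_all add: integrable_of_third_moment(1,2)[of "\<lambda>x. x", OF _ third])
  have c3: "norm (char M u - (1 - u\<^sup>2 / 2)) \<le> \<beta> / 6 * \<bar>u\<bar> ^ 3" for u
  proof -
    have "norm (char M u - (1 - u\<^sup>2 * 1 / 2)) \<le> (u\<^sup>2 / 6) * expectation (\<lambda>x. min (6 * x\<^sup>2) (\<bar>u\<bar> * \<bar>x\<bar> ^ 3))"
      by (rule char_approx3[OF i1 mean i2]) (simp add: mean var)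
    also have "\<dots> \<le> u\<^sup>2 / 6 * (\<bar>u\<bar> * \<beta>)"
    proof (rule mult_left_mono)
      have "expectation (\<lambda>x. min (6 * x\<^sup>2) (\<bar>u\<bar> * \<bar>x\<bar> ^ 3)) \<le> expectation (\<lambda>x. \<bar>u\<bar> * \<bar>x\<bar> ^ 3)"
        by (rule integral_mono') (use third in auto)
      then show "expectation (\<lambda>x. min (6 * x\<^sup>2) (\<bar>u\<bar> * \<bar>x\<bar> ^ 3)) \<le> \<bar>u\<bar> * \<beta>"
        by (simp add: \<beta>_def)
    qed simp
    also have "u\<^sup>2 / 6 * (\<bar>u\<bar> * \<beta>) = \<beta> / 6 * \<bar>u\<bar> ^ 3"
      by (simp add: power2_eq_square power3_eq_cube abs_mult_self_eq)
    finally show ?thesis by simp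
  qed
  show ?thesis
  proof (rule that[of "\<beta> / 6 + 1"])
    show "\<beta> / 6 + 1 \<ge> 1" using \<open>\<beta> \<ge> 0\<close> by simp
    show "norm (char M u - exp (- u\<^sup>2 / 2)) \<le> (\<beta> / 6 + 1) * \<bar>u\<bar> ^ 3" for u
    proof -
      have "norm (complex_of_real (1 - u\<^sup>2 / 2) - complex_of_real (exp (- u\<^sup>2 / 2))) \<le> \<bar>u\<bar> ^ 3"
        using abs_exp_minus_taylor_cube_le[of u] by (metis norm_of_real of_real_diff)
      then show ?thesis
        using c3[of u] norm_triangle_ineq[of "char M u - (1 - u\<^sup>2 / 2)" "complex_of_real (1 - u\<^sup>2 / 2) - complex_of_real (exp (- u\<^sup>2 / 2))"]
        by (simp add: algebra_simps)
    qed
    show "norm (char M u) \<le> exp (- u\<^sup>2 / 4)" if u: "(\<beta> / 6 + 1) * \<bar>u\<bar> \<le> 1 / 4" for u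
    proof -
      \<comment> \<open>The window keeps \<open>\<bar>u\<bar>\<close> below 1, so
        \<open>1 - u\<^sup>2 / 2\<close> is nonnegative and equals its modulus.\<close>
      have "\<bar>u\<bar> \<le> (\<beta> / 6 + 1) * \<bar>u\<bar>" using \<open>\<beta> \<ge> 0\<close> by (simp add: algebra_simps)
      then have "u\<^sup>2 \<le> 1" using u by (simp add: abs_square_le_1)
      then have n: "norm (complex_of_real (1 - u\<^sup>2 / 2)) = 1 - u\<^sup>2 / 2" by (simp only: norm_of_real)
      have "\<beta> / 6 * \<bar>u\<bar> ^ 3 = (\<beta> / 6 * \<bar>u\<bar>) * u\<^sup>2" by (simp add: power2_eq_square power3_eq_cube abs_mult_self_eq)
      also have "\<dots> \<le> 1 / 4 * u\<^sup>2" using u by (intro mult_right_mono) (auto simp: algebra_simps)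
      finally have "norm (char M u) \<le> 1 - u\<^sup>2 / 2 + 1 / 4 * u\<^sup>2"
        using c3[of u] n norm_triangle_sub[of "char M u" "complex_of_real (1 - u\<^sup>2 / 2)"] by auto
      also have "\<dots> \<le> exp (- u\<^sup>2 / 4)" using exp_ge_add_one_self[of "- u\<^sup>2 / 4"] by simp
      finally show ?thesis .
    qed
  qed
qed

section \<open>The standard normal distribution\<close>

lemma char_distr_mult:
  assumes "real_distribution M"
  shows "char (distr M borel (\<lambda>x. c * x)) t = char M (c * t)"
proof -
  interpret real_distribution M by fact
  show ?thesis unfolding char_def by (subst integral_distr) (auto simp: mult_ac)
qed

lemma cdf_distr_mult:
  assumes "real_distribution M" "c > 0"
  shows "cdf (distr M borel (\<lambda>x. c * x)) t = cdf M (t / c)"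
proof -
  interpret real_distribution M by fact
  show ?thesis unfolding cdf_def
    by (subst measure_distr) (use assms in \<open>auto intro!: arg_cong[where f="measure M"] simp: field_simps\<close>)
qed

lemma measure_std_normal:
  assumes [measurable]: "A \<in> sets borel"
  shows "measure std_normal_distribution A = (LBINT x. indicator A x * std_normal_density x)"
    "integrable lborel (\<lambda>x. indicator A x * std_normal_density x)"
proof -
  show i: "integrable lborel (\<lambda>x. indicator A x * std_normal_density x)"
    using integrable_real_mult_indicator[of A lborel std_normal_density] by (simp add: mult.commute)
  show "measure std_normal_distribution A = (LBINT x. indicator A x * std_normal_density x)"
    unfolding measure_def
    by (subst emeasure_density) (auto simp: integral_eq_nn_integral ennreal_mult' ennreal_indicator mult.commute)
qed

text \<open>Half of the exponent is bounded by its value at \<open>a\<close>; the other half is a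
  multiple of the normal density with variance 2 and integrates explicitly.\<close>

lemma std_normal_tail_le:
  assumes A: "A \<in> sets borel" and a: "\<And>x. x \<in> A \<Longrightarrow> a \<le> \<bar>x\<bar>" "a \<ge> 0"
  shows "measure std_normal_distribution A \<le> 2 * exp (- a\<^sup>2 / 4)"
proof -
  have "measure std_normal_distribution A \<le> (LBINT x. sqrt 2 * exp (- a\<^sup>2 / 4) * normal_density 0 (sqrt 2) x)"
    unfolding measure_std_normal(1)[OF A]
  proof (rule integral_mono[OF measure_std_normal(2)[OF A]])
    fix x :: real
    show "indicator A x * std_normal_density x \<le> sqrt 2 * exp (- a\<^sup>2 / 4) * normal_density 0 (sqrt 2) x"
    proof (cases "x \<in> A")
      case True
      then have "a\<^sup>2 \<le> x\<^sup>2" using a by (metis abs_of_nonneg power2_abs power_mono)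
      have "std_normal_density x = 1 / sqrt (2 * pi) * (exp (- x\<^sup>2 / 4) * exp (- x\<^sup>2 / 4))"
        unfolding std_normal_density_def by (simp flip: exp_add)
      also have "\<dots> \<le> 1 / sqrt (2 * pi) * (exp (- a\<^sup>2 / 4) * exp (- x\<^sup>2 / 4))"
        using \<open>a\<^sup>2 \<le> x\<^sup>2\<close> by (intro mult_left_mono mult_right_mono) auto
      also have "\<dots> = sqrt 2 * exp (- a\<^sup>2 / 4) * normal_density 0 (sqrt 2) x"
      proof -
        have "sqrt (2 * pi * 2) = sqrt (2 * pi) * sqrt 2" by (rule real_sqrt_mult)
        then have "normal_density 0 (sqrt 2) x = exp (- x\<^sup>2 / 4) / (sqrt (2 * pi) * sqrt 2)"
          by (simp add: normal_density_def)
        then show ?thesis by simp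
      qed
      finally show ?thesis using True by simp
    qed simp
  qed auto
  also have "\<dots> = sqrt 2 * exp (- a\<^sup>2 / 4)" by simp
  also have "\<dots> \<le> 2 * exp (- a\<^sup>2 / 4)" using real_sqrt_le_iff[of 2 4] by (intro mult_right_mono) auto
  finally show ?thesis .
qed

text \<open>To the right of \<open>x - 1\<close> the distribution function is a constant plus an
  integral of the continuous density over a compact interval, so the fundamental theorem of calculus
  applies.\<close>

lemma DERIV_cdf_std_normal:
  "(cdf std_normal_distribution has_real_derivative std_normal_density x) (at x)"
proof -
  interpret real_distribution std_normal_distribution by (rule real_dist_normal_dist)
  have cont: "continuous_on A std_normal_density" for A
    unfolding std_normal_density_def by (intro continuous_intros) auto
  have eq: "cdf std_normal_distribution y = cdf std_normal_distribution (x - 1) + integral {x - 1..y} std_normal_density"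
    if "y > x - 1" for y
  proof -
    have "cdf std_normal_distribution y - cdf std_normal_distribution (x - 1) = (LBINT u. indicator {x - 1<..y} u * std_normal_density u)"
      unfolding cdf_diff_eq[OF that] by (rule measure_std_normal) simp
    also have "\<dots> = (LBINT u:{x - 1..y}. std_normal_density u)"
      unfolding set_lebesgue_integral_def
      by (rule integral_cong_AE) (auto intro!: AE_I[of _ _ "{x - 1}"] split: split_indicator)
    also have "\<dots> = integral {x - 1..y} std_normal_density"
      by (rule set_borel_integral_eq_integral) (use measure_std_normal(2)[of "{x - 1..y}"] in \<open>simp add: set_integrable_def\<close>)
    finally show ?thesis by simp
  qed
  have "((\<lambda>y. integral {x - 1..y} std_normal_density) has_real_derivative std_normal_density x) (at x within {x - 1..x + 1})"
    by (rule integral_has_real_derivative[OF cont]) auto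
  then have "((\<lambda>y. integral {x - 1..y} std_normal_density) has_real_derivative std_normal_density x) (at x)"
    by (subst (asm) at_within_interior) auto
  then have d: "((\<lambda>y. cdf std_normal_distribution (x - 1) + integral {x - 1..y} std_normal_density) has_real_derivative std_normal_density x) (at x)"
    by (auto intro!: derivative_eq_intros)
  have ev: "\<forall>\<^sub>F y in nhds x. cdf std_normal_distribution y = cdf std_normal_distribution (x - 1) + integral {x - 1..y} std_normal_density"
    by (rule eventually_mono[OF eventually_nhds_in_open[of "{x - 1<..}"]]) (auto simp: eq)
  show ?thesis using d DERIV_cong_ev[OF refl ev refl] by blast
qed

lemma cdf_std_normal_lipschitz:
  assumes "x \<le> y"
  shows "cdf std_normal_distribution y - cdf std_normal_distribution x \<le> y - x"
proof -
  have "cdf std_normal_distribution y - y \<le> cdf std_normal_distribution x - x"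
  proof (rule DERIV_nonpos_imp_nonincreasing[OF assms])
    fix u :: real
    have "((\<lambda>x. cdf std_normal_distribution x - x) has_real_derivative std_normal_density u - 1) (at u)"
      by (auto intro!: derivative_eq_intros DERIV_cdf_std_normal)
    moreover have "std_normal_density u \<le> 1"
    proof -
      have "1 * 1 \<le> 2 * pi" using pi_ge_two by (intro mult_mono) auto
      then have "1 \<le> sqrt (2 * pi)" by simp
      then have "1 / sqrt (2 * pi) \<le> 1" by simp
      then have "1 / sqrt (2 * pi) * exp (- u\<^sup>2 / 2) \<le> 1 * 1"
        by (intro mult_mono) auto
      then show ?thesis unfolding std_normal_density_def by simp
    qed
    ultimately show "\<exists>z. ((\<lambda>x. cdf std_normal_distribution x - x) has_real_derivative z) (at u) \<and> z \<le> 0"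
      by force
  qed
  then show ?thesis by simp
qed

text \<open>Let \<open>p\<close> be the derivative of
  \<open>\<lambda>u. \<Phi> (x * sqrt (1 + u))\<close>, with \<Phi> the standard normal distribution
  function. The left side without the absolute value vanishes at \<open>r = 0\<close> and has
  derivative \<open>p r + p (- r) - 2 * p 0\<close>. A Lipschitz constant 24 for \<open>p\<close>,
  uniform in \<open>x\<close>, bounds this by \<open>48 * r\<close>, and the mean value inequality
  gives the claim.\<close>

lemma cdf_std_normal_symmetric_difference:
  fixes x r :: real
  assumes r: "0 \<le> r" "r \<le> 1 / 2"
  shows "\<bar>cdf std_normal_distribution (x * sqrt (1 + r)) - cdf std_normal_distribution (x * sqrt (1 - r))
      - x * exp (- x\<^sup>2 / 2) / sqrt (2 * pi) * r\<bar> \<le> 48 * r\<^sup>2"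
proof -
  define c where "c = 1 / (2 * sqrt (2 * pi))"
  define p where "p u = c * x * exp (- x\<^sup>2 * (1 + u) / 2) / sqrt (1 + u)" for u
  define p' where "p' u = - c * exp (- x\<^sup>2 * (1 + u) / 2) * (x ^ 3 / 2 / sqrt (1 + u) + x / 2 / sqrt (1 + u) ^ 3)" for u
  have "1 * 1 \<le> 2 * pi" using pi_ge_two by (intro mult_mono) auto
  then have "1 \<le> sqrt (2 * pi)" by simp
  then have c: "0 \<le> c" "c \<le> 1 / 2" unfolding c_def by (auto simp: field_simps)
  have d_cdf: "((\<lambda>u. cdf std_normal_distribution (x * sqrt (1 + u))) has_real_derivative p u) (at u)"
    if "\<bar>u\<bar> < 1" for u
  proof -
    have "((\<lambda>u. x * sqrt (1 + u)) has_real_derivative x * ((inverse (sqrt (1 + u))) / 2)) (at u)"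
      using that by (auto intro!: derivative_eq_intros)
    then have "((\<lambda>u. cdf std_normal_distribution (x * sqrt (1 + u))) has_real_derivative
        std_normal_density (x * sqrt (1 + u)) * (x * ((inverse (sqrt (1 + u))) / 2))) (at u)"
      by (rule DERIV_chain2[OF DERIV_cdf_std_normal])
    also have "std_normal_density (x * sqrt (1 + u)) * (x * ((inverse (sqrt (1 + u))) / 2)) = p u"
    proof -
      have "(x * sqrt (1 + u))\<^sup>2 = x\<^sup>2 * (1 + u)" using that by (simp add: power_mult_distrib)
      then show ?thesis unfolding p_def c_def std_normal_density_def by (simp add: inverse_eq_divide mult_ac)
    qed
    finally show ?thesis .
  qed
  have d_p: "(p has_real_derivative p' u) (at u)" if "\<bar>u\<bar> < 1" for u
  proof -
    define s where "s = sqrt (1 + u)"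
    have s: "s > 0" "s * s = 1 + u" using that by (auto simp: s_def)
    have "((\<lambda>u. c * x * exp (- x\<^sup>2 * (1 + u) / 2)) has_real_derivative
        c * x * exp (- x\<^sup>2 * (1 + u) / 2) * (- x\<^sup>2 / 2)) (at u)"
      by (auto intro!: derivative_eq_intros)
    moreover have "((\<lambda>u. sqrt (1 + u)) has_real_derivative inverse s / 2) (at u)"
      using that unfolding s_def by (auto intro!: derivative_eq_intros)
    ultimately have "(p has_real_derivative
        ((c * x * exp (- x\<^sup>2 * (1 + u) / 2) * (- x\<^sup>2 / 2)) * s
          - c * x * exp (- x\<^sup>2 * (1 + u) / 2) * (inverse s / 2)) / (s * s)) (at u)"
      unfolding p_def[abs_def] s_def using that by (intro DERIV_divide) auto
    also have "((c * x * exp (- x\<^sup>2 * (1 + u) / 2) * (- x\<^sup>2 / 2)) * s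
          - c * x * exp (- x\<^sup>2 * (1 + u) / 2) * (inverse s / 2)) / (s * s) = p' u"
    proof -
      define E where "E = exp (- x\<^sup>2 * (1 + u) / 2)"
      show ?thesis unfolding p'_def s_def[symmetric] E_def[symmetric]
        using s(1) by (simp add: field_simps power2_eq_square power3_eq_cube)
    qed
    finally show ?thesis .
  qed
  have p'_le: "\<bar>p' u\<bar> \<le> 24" if "\<bar>u\<bar> \<le> 1 / 2" for u
  proof -
    \<comment> \<open>Since \<open>1 + u \<ge> 1 / 2\<close>, the Gaussian factor in
      \<open>p'\<close> is at most \<open>exp (- y)\<close>. The polynomial factors are bounded by
      multiples of \<open>exp y\<close> through its quadratic Taylor polynomial, so the dependence
      on \<open>x\<close> cancels.\<close>
    define y where "y = x\<^sup>2 / 4"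
    define s where "s = sqrt (1 + u)"
    have "1 / 2 \<le> s" unfolding s_def using that by (intro real_le_rsqrt) (auto simp: power2_eq_square)
    then have s: "1 / s \<le> 2" "s > 0" by (auto simp: field_simps)
    have "y \<ge> 0" by (simp add: y_def)
    have e: "1 + y + y\<^sup>2 / 2 \<le> exp y" using \<open>y \<ge> 0\<close> by (rule exp_lower_Taylor_quadratic)
    have "0 \<le> y\<^sup>2" by simp
    have "0 \<le> (\<bar>x\<bar> - 1)\<^sup>2" by simp
    then have "2 * \<bar>x\<bar> \<le> 1 + 4 * y" by (simp add: power2_diff y_def)
    then have x1: "\<bar>x\<bar> \<le> 4 * exp y" using e \<open>y \<ge> 0\<close> \<open>0 \<le> y\<^sup>2\<close> by linarith
    have "\<bar>x\<bar> ^ 3 \<le> 1 + x ^ 4"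
    proof (cases "\<bar>x\<bar> \<le> 1")
      case True
      then have "\<bar>x\<bar> ^ 3 \<le> 1" by (intro power_le_one) auto
      moreover have "0 \<le> x ^ 4" by simp
      ultimately show ?thesis by linarith
    next
      case False
      then have "\<bar>x\<bar> ^ 3 \<le> \<bar>x\<bar> ^ 4" by (intro power_increasing) auto
      then show ?thesis by simp
    qed
    also have "\<dots> = 1 + 16 * y\<^sup>2" by (simp add: y_def power_divide flip: power_mult)
    finally have x3: "\<bar>x\<bar> ^ 3 \<le> 32 * exp y" using e \<open>y \<ge> 0\<close> by linarith
    have ex: "exp (- x\<^sup>2 * (1 + u) / 2) \<le> exp (- y)"
    proof -
      have "x\<^sup>2 * (1 / 2) \<le> x\<^sup>2 * (1 + u)" using that by (intro mult_left_mono) auto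
      then show ?thesis by (simp add: y_def)
    qed
    have "\<bar>x ^ 3 / 2 / s + x / 2 / s ^ 3\<bar> \<le> \<bar>x\<bar> ^ 3 / 2 * (1 / s) + \<bar>x\<bar> / 2 * (1 / s) ^ 3"
      using s by (intro order_trans[OF abs_triangle_ineq]) (simp add: abs_mult power_abs power_divide)
    also have "\<dots> \<le> 32 * exp y / 2 * 2 + 4 * exp y / 2 * 2 ^ 3"
      using s x1 x3 by (intro add_mono mult_mono power_mono divide_right_mono) auto
    also have "\<dots> = 48 * exp y" by simp
    finally have "\<bar>p' u\<bar> \<le> 1 / 2 * exp (- y) * (48 * exp y)"
      unfolding p'_def abs_mult s_def[symmetric] using c ex by (intro mult_mono) auto
    also have "\<dots> = 24" by (simp add: exp_minus)
    finally show ?thesis .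
  qed
  have p_lip: "\<bar>p u - p 0\<bar> \<le> 24 * \<bar>u\<bar>" if "\<bar>u\<bar> \<le> 1 / 2" for u
  proof -
    have "norm (p u - p 0) \<le> 24 * norm (u - 0)"
      by (rule field_differentiable_bound[of "{- 1 / 2..1 / 2}" p p'])
        (use d_p p'_le that in \<open>auto intro: has_field_derivative_at_within\<close>)
    then show ?thesis by simp
  qed
  \<comment> \<open>Writing \<open>1 + - r\<close> exposes the second term as the first function at
    \<open>- r\<close>, so the chain rule can reuse \<open>d_cdf\<close>.\<close>
  define D where "D r = cdf std_normal_distribution (x * sqrt (1 + r)) - cdf std_normal_distribution (x * sqrt (1 + - r))
      - 2 * p 0 * r" for r
  have "norm (D r - D 0) \<le> 48 * r * norm (r - 0)"
  proof (rule field_differentiable_bound[of "{0..r}"])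
    fix u assume u: "u \<in> {0..r}"
    have "((\<lambda>u. cdf std_normal_distribution (x * sqrt (1 + - u))) has_real_derivative p (- u) * - 1) (at u)"
      by (rule DERIV_chain2[where f="\<lambda>u. cdf std_normal_distribution (x * sqrt (1 + u))"])
        (use u r in \<open>auto intro!: d_cdf derivative_eq_intros\<close>)
    then have "(D has_real_derivative p u + p (- u) - 2 * p 0) (at u)"
      unfolding D_def using u r by (auto intro!: derivative_eq_intros d_cdf)
    then show "(D has_real_derivative p u + p (- u) - 2 * p 0) (at u within {0..r})"
      by (rule DERIV_subset) simp
    show "norm (p u + p (- u) - 2 * p 0) \<le> 48 * r"
      using p_lip[of u] p_lip[of "- u"] u r by auto
  qed (use r in auto)
  moreover have "2 * p 0 = x * exp (- x\<^sup>2 / 2) / sqrt (2 * pi)" by (simp add: p_def c_def)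
  ultimately show ?thesis using r by (simp add: D_def power2_eq_square)
qed

section \<open>A Berry--Esseen bound for two blocks\<close>

text \<open>Telescoping as a geometric sum. Keeping the factor \<open>r ^ (n - 1)\<close> rather
  than 1 preserves the decay of the remaining factors.\<close>

lemma norm_power_diff_le:
  fixes z w :: "'a::{real_normed_algebra_1, comm_ring_1}"
  assumes "norm z \<le> r" "norm w \<le> r"
  shows "norm (z ^ n - w ^ n) \<le> real n * r ^ (n - 1) * norm (z - w)"
proof -
  have "r \<ge> 0" using assms(1) norm_ge_zero order_trans by blast
  have "z ^ n - w ^ n = (z - w) * (\<Sum>i<n. w ^ (n - Suc i) * z ^ i)"
    by (rule power_diff_sumr2)
  also have "norm \<dots> \<le> norm (z - w) * norm (\<Sum>i<n. w ^ (n - Suc i) * z ^ i)"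
    by (rule norm_mult_ineq)
  also have "\<dots> \<le> norm (z - w) * (\<Sum>i<n. r ^ (n - 1))"
  proof (intro mult_left_mono sum_norm_le)
    fix i assume "i \<in> {..<n}"
    then have e: "n - 1 = (n - Suc i) + i" by auto
    have "norm (w ^ (n - Suc i) * z ^ i) \<le> norm (w ^ (n - Suc i)) * norm (z ^ i)" by (rule norm_mult_ineq)
    also have "\<dots> \<le> norm w ^ (n - Suc i) * norm z ^ i" by (intro mult_mono norm_power_ineq) auto
    also have "\<dots> \<le> r ^ (n - Suc i) * r ^ i" using assms \<open>r \<ge> 0\<close> by (intro mult_mono power_mono) auto
    finally show "norm (w ^ (n - Suc i) * z ^ i) \<le> r ^ (n - 1)" unfolding e by (simp add: power_add)
  qed simp
  finally show ?thesis by (simp add: mult_ac)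
qed

text \<open>The blocks are replaced by Gaussians one after the other. In the first exchange the
  decay comes from the \<open>k - 1\<close> untouched factors of the first block; in the second it
  comes from the Gaussian \<open>w ^ k\<close> already in place. The second block itself is only
  bounded by 1, so the window for \<open>t\<close> involves \<open>a\<close> alone.\<close>

lemma char_two_blocks_approx:
  fixes \<phi> :: "real \<Rightarrow> complex" and k m :: nat and a b t :: real
  assumes B: "B \<ge> 0"
    and C1: "\<And>u. norm (\<phi> u - exp (- u\<^sup>2 / 2)) \<le> B * \<bar>u\<bar> ^ 3"
    and C2: "\<And>u. B * \<bar>u\<bar> \<le> 1 / 4 \<Longrightarrow> norm (\<phi> u) \<le> exp (- u\<^sup>2 / 4)"
    and C3: "\<And>u. norm (\<phi> u) \<le> 1"
    and a: "a > 0" and b: "b \<ge> 0" and ka: "1 / 8 \<le> (real k - 1) * a\<^sup>2"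
    and t: "B * a * \<bar>t\<bar> \<le> 1 / 4"
  shows "norm (\<phi> (a * t) ^ k * \<phi> (- b * t) ^ m - exp (- (real k * a\<^sup>2 + real m * b\<^sup>2) * t\<^sup>2 / 2))
     \<le> B * (real k * a ^ 3 + real m * b ^ 3) * \<bar>t\<bar> ^ 3 * exp (- t\<^sup>2 / 32)"
proof -
  define w where "w = complex_of_real (exp (- (a * t)\<^sup>2 / 2))"
  define v where "v = complex_of_real (exp (- (b * t)\<^sup>2 / 2))"
  define r where "r = exp (- (a * t)\<^sup>2 / 4)"
  have "real k - 1 > 0"
  proof (rule ccontr)
    assume "\<not> real k - 1 > 0"
    then have "(real k - 1) * a\<^sup>2 \<le> 0" by (intro mult_nonpos_nonneg) auto
    then show False using ka by simp
  qed
  then have "k \<ge> 1" by simp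
  have za: "norm (\<phi> (a * t)) \<le> r" unfolding r_def by (rule C2) (use t a in \<open>simp add: abs_mult mult_ac\<close>)
  have wr: "norm w \<le> r" unfolding w_def r_def by simp
  \<comment> \<open>The constant 32 is 4 times 8: the exponent of \<open>r\<close> carries 1/4, and
    \<open>(k - 1) * a\<^sup>2\<close> is at least 1/8.\<close>
  have rk: "r ^ (k - 1) \<le> exp (- t\<^sup>2 / 32)"
  proof -
    have "r ^ (k - 1) = exp (real (k - 1) * (- (a * t)\<^sup>2 / 4))" unfolding r_def by (rule exp_of_nat_mult[symmetric])
    also have "real (k - 1) * (- (a * t)\<^sup>2 / 4) = - ((real k - 1) * a\<^sup>2) * t\<^sup>2 / 4"
      using \<open>k \<ge> 1\<close> by (simp add: of_nat_diff power_mult_distrib)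
    also have "\<dots> \<le> - (1 / 8) * t\<^sup>2 / 4" using mult_right_mono[OF ka, of "t\<^sup>2"] by simp
    finally show ?thesis by simp
  qed
  have wk: "norm (w ^ k) \<le> exp (- t\<^sup>2 / 32)"
  proof -
    obtain j where "k = Suc j" using \<open>k \<ge> 1\<close> by (cases k) auto
    then have "norm (w ^ k) = norm w ^ (k - 1) * norm w" by (simp add: norm_mult norm_power mult.commute)
    also have "\<dots> \<le> r ^ (k - 1) * 1" using wr by (intro mult_mono power_mono) (auto simp: w_def r_def)
    finally show ?thesis using rk by simp
  qed
  have d1: "norm (\<phi> (a * t) ^ k - w ^ k) \<le> B * (real k * a ^ 3) * \<bar>t\<bar> ^ 3 * exp (- t\<^sup>2 / 32)"
  proof -
    have "norm (\<phi> (a * t) ^ k - w ^ k) \<le> real k * r ^ (k - 1) * norm (\<phi> (a * t) - w)"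
      by (rule norm_power_diff_le[OF za wr])
    also have "\<dots> \<le> real k * exp (- t\<^sup>2 / 32) * (B * \<bar>a * t\<bar> ^ 3)"
      unfolding w_def by (intro mult_mono C1 rk) (auto simp: r_def)
    finally show ?thesis using a by (simp add: abs_mult power_mult_distrib mult_ac)
  qed
  have d2: "norm (\<phi> (- b * t) ^ m - v ^ m) \<le> B * (real m * b ^ 3) * \<bar>t\<bar> ^ 3"
  proof -
    have "norm (\<phi> (- b * t) ^ m - v ^ m) \<le> real m * 1 ^ (m - 1) * norm (\<phi> (- b * t) - v)"
      by (rule norm_power_diff_le) (auto simp: v_def C3)
    also have "\<dots> \<le> real m * 1 ^ (m - 1) * (B * \<bar>- b * t\<bar> ^ 3)"
      unfolding v_def using C1[of "- b * t"] by (intro mult_left_mono) auto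
    finally show ?thesis using b by (simp add: abs_mult power_mult_distrib mult_ac)
  qed
  have gv: "complex_of_real (exp (- (real k * a\<^sup>2 + real m * b\<^sup>2) * t\<^sup>2 / 2)) = w ^ k * v ^ m"
    unfolding w_def v_def of_real_power[symmetric] of_real_mult[symmetric] exp_of_nat_mult[symmetric] exp_add[symmetric]
    by (simp add: power_mult_distrib field_simps)
  have "\<phi> (a * t) ^ k * \<phi> (- b * t) ^ m - w ^ k * v ^ m
      = (\<phi> (a * t) ^ k - w ^ k) * \<phi> (- b * t) ^ m + w ^ k * (\<phi> (- b * t) ^ m - v ^ m)"
    by (simp add: algebra_simps)
  also have "norm \<dots> \<le> norm (\<phi> (a * t) ^ k - w ^ k) * norm (\<phi> (- b * t) ^ m) + norm (w ^ k) * norm (\<phi> (- b * t) ^ m - v ^ m)"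
    by (intro order_trans[OF norm_triangle_ineq]) (simp add: norm_mult)
  also have "\<dots> \<le> B * (real k * a ^ 3) * \<bar>t\<bar> ^ 3 * exp (- t\<^sup>2 / 32) * 1 + exp (- t\<^sup>2 / 32) * (B * (real m * b ^ 3) * \<bar>t\<bar> ^ 3)"
    using B a b by (intro add_mono mult_mono d1 d2 wk) (auto simp: norm_power intro!: power_le_one C3)
  finally show ?thesis unfolding gv by (simp add: algebra_simps)
qed

text \<open>Moments of order 0 and 2 of a normal density, freed from its normalization; they
  integrate the two parts of the majorant in the smoothing argument.\<close>

lemma has_bochner_integral_gauss:
  assumes "s > 0"
  shows "has_bochner_integral lborel (\<lambda>x. exp (- x\<^sup>2 / (2 * s\<^sup>2))) (sqrt (2 * pi) * s)"
    and "has_bochner_integral lborel (\<lambda>x. x\<^sup>2 * exp (- x\<^sup>2 / (2 * s\<^sup>2))) (sqrt (2 * pi) * s ^ 3)"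
proof -
  have e: "exp (- x\<^sup>2 / (2 * s\<^sup>2)) = sqrt (2 * pi) * s * normal_density 0 s x" for x
    using assms by (simp add: normal_density_def real_sqrt_mult)
  have "has_bochner_integral lborel (\<lambda>x. normal_density 0 s x) 1"
    using normal_moment_even[OF assms, of 0 0] by simp
  then show "has_bochner_integral lborel (\<lambda>x. exp (- x\<^sup>2 / (2 * s\<^sup>2))) (sqrt (2 * pi) * s)"
    unfolding e using has_bochner_integral_mult_right[of "sqrt (2 * pi) * s" lborel _ 1] by simp
  have "has_bochner_integral lborel (\<lambda>x. normal_density 0 s x * x\<^sup>2) (s\<^sup>2)"
    using normal_moment_even[OF assms, of 0 1] by simp
  then have "has_bochner_integral lborel (\<lambda>x. sqrt (2 * pi) * s * (normal_density 0 s x * x\<^sup>2)) (sqrt (2 * pi) * s * s\<^sup>2)"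
    by (intro has_bochner_integral_mult_right)
  then show "has_bochner_integral lborel (\<lambda>x. x\<^sup>2 * exp (- x\<^sup>2 / (2 * s\<^sup>2))) (sqrt (2 * pi) * s ^ 3)"
    unfolding e by (simp add: mult_ac power2_eq_square power3_eq_cube)
qed

text \<open>Both \<open>M\<close> and the Gaussian \<open>G\<close> of matching variance are
  smoothed by a Gaussian \<open>N\<close> of width \<open>\<epsilon>\<close>. For small
  \<open>t\<close> the characteristic functions are compared directly; for large \<open>t\<close>
  the damping of \<open>N\<close> suffices. The term \<open>a * l\<^sup>2\<close> is the price of
  removing the smoothing, and \<open>exp (- l\<^sup>2 / 4)\<close> comes from the damping and from
  the tails of \<open>N\<close>.\<close>

lemma berry_esseen_two_blocks:
  fixes \<mu> M :: "real measure" and k m :: nat and a b l x B :: real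
  assumes \<mu>: "real_distribution \<mu>" and M: "real_distribution M"
    and B: "B \<ge> 1"
    and C1: "\<And>u. norm (char \<mu> u - exp (- u\<^sup>2 / 2)) \<le> B * \<bar>u\<bar> ^ 3"
    and C2: "\<And>u. B * \<bar>u\<bar> \<le> 1 / 4 \<Longrightarrow> norm (char \<mu> u) \<le> exp (- u\<^sup>2 / 4)"
    and char_M: "\<And>t. char M t = char \<mu> (a * t) ^ k * char \<mu> (- b * t) ^ m"
    and a: "a > 0" and b: "b \<ge> 0" and ka: "1 / 8 \<le> (real k - 1) * a\<^sup>2" and l: "l \<ge> 1"
  shows "\<bar>cdf M x - cdf std_normal_distribution (x / sqrt (real k * a\<^sup>2 + real m * b\<^sup>2))\<bar>
    \<le> 64 * B * (real k * a ^ 3 + real m * b ^ 3 + a * l\<^sup>2 + exp (- l\<^sup>2 / 4))"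
proof -
  define L where "L = real k * a ^ 3 + real m * b ^ 3"
  define s where "s = sqrt (real k * a\<^sup>2 + real m * b\<^sup>2)"
  \<comment> \<open>\<open>T\<close> is the edge of the window
    \<open>B * a * \<bar>t\<bar> \<le> 1 / 4\<close>, and \<open>\<epsilon>\<close> is chosen so
    that \<open>\<epsilon> * T = l\<close>: at the edge the damping is already
    \<open>exp (- l\<^sup>2 / 2)\<close>.\<close>
  define \<epsilon> where "\<epsilon> = 4 * B * a * l"
  define T where "T = 1 / (4 * B * a)"
  define G where "G = distr std_normal_distribution borel (\<lambda>z. s * z)"
  define N where "N = distr std_normal_distribution borel (\<lambda>z. \<epsilon> * z)"
  define g where "g t = B * L * (t\<^sup>2 * exp (- t\<^sup>2 / 32)) + 2 / T * exp (- l\<^sup>2 / 4) * exp (- \<epsilon>\<^sup>2 * t\<^sup>2 / 4)" for t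
  interpret Z: real_distribution std_normal_distribution by (rule real_dist_normal_dist)
  have G: "real_distribution G" and N: "real_distribution N"
    unfolding G_def N_def by (auto intro!: Z.real_distribution_distr)
  have pos: "L \<ge> 0" "\<epsilon> > 0" "T > 0" "\<epsilon> * T = l"
    using a b B l by (auto simp: L_def \<epsilon>_def T_def)
  have ka2: "1 / 8 \<le> real k * a\<^sup>2" using ka zero_le_power2[of a] unfolding left_diff_distrib by linarith
  have "0 \<le> real m * b\<^sup>2" by simp
  \<comment> \<open>Lowering 1/8 to the square 1/9 yields the Lipschitz constant 3 for the
    distribution function of \<open>G\<close>.\<close>
  then have "1 / 9 \<le> real k * a\<^sup>2 + real m * b\<^sup>2" using ka2 by linarith
  then have s: "s \<ge> 1 / 3" unfolding s_def by (intro real_le_rsqrt) (simp add: power2_eq_square)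
  have cG: "char G t = exp (- (real k * a\<^sup>2 + real m * b\<^sup>2) * t\<^sup>2 / 2)" for t
    unfolding G_def char_distr_mult[OF real_dist_normal_dist] char_std_normal_distribution
    by (simp add: s_def power_mult_distrib algebra_simps)
  have cN: "char N t = exp (- \<epsilon>\<^sup>2 * t\<^sup>2 / 2)" for t
    unfolding N_def char_distr_mult[OF real_dist_normal_dist] char_std_normal_distribution
    by (simp add: power_mult_distrib)
  have bound: "norm (char (M \<star> N) t - char (G \<star> N) t) \<le> \<bar>t\<bar> * g t" for t
  proof -
    have e: "norm (char (M \<star> N) t - char (G \<star> N) t) = norm (char M t - char G t) * exp (- \<epsilon>\<^sup>2 * t\<^sup>2 / 2)"
      unfolding char_convolution[OF M N] char_convolution[OF G N] cN left_diff_distrib[symmetric] norm_mult by simp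
    show ?thesis
    proof (cases "\<bar>t\<bar> \<le> T")
      case True
      then have t: "B * a * \<bar>t\<bar> \<le> 1 / 4" using a B by (simp add: T_def field_simps)
      have "norm (char M t - char G t) \<le> B * L * \<bar>t\<bar> ^ 3 * exp (- t\<^sup>2 / 32)"
        unfolding char_M cG L_def
        by (rule char_two_blocks_approx)
          (use a b B ka t C1 C2 real_distribution.cmod_char_le_1[OF \<mu>] in auto)
      then have "norm (char M t - char G t) * exp (- \<epsilon>\<^sup>2 * t\<^sup>2 / 2) \<le> (B * L * \<bar>t\<bar> ^ 3 * exp (- t\<^sup>2 / 32)) * 1"
        by (intro mult_mono) (use pos B in auto)
      also have "\<dots> = \<bar>t\<bar> * (B * L * (t\<^sup>2 * exp (- t\<^sup>2 / 32)))"
        by (simp add: power2_eq_square power3_eq_cube mult_ac flip: abs_mult)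
      also have "\<dots> \<le> \<bar>t\<bar> * g t" unfolding g_def using pos by (intro mult_left_mono) auto
      finally show ?thesis unfolding e .
    next
      case False
      have "norm (char M t - char G t) \<le> 2"
        using norm_triangle_ineq4[of "char M t" "char G t"] real_distribution.cmod_char_le_1[OF M, of t]
          real_distribution.cmod_char_le_1[OF G, of t] by linarith
      \<comment> \<open>Half of the damping exponent supplies the small factor; the other half is
        kept so that the majorant remains integrable.\<close>
      moreover have "exp (- \<epsilon>\<^sup>2 * t\<^sup>2 / 2) \<le> exp (- l\<^sup>2 / 4) * exp (- \<epsilon>\<^sup>2 * t\<^sup>2 / 4)"
      proof -
        have "T\<^sup>2 \<le> t\<^sup>2" using False pos by (metis abs_of_pos linorder_le_cases abs_le_square_iff)
        then have "l\<^sup>2 \<le> \<epsilon>\<^sup>2 * t\<^sup>2" using pos(4)[symmetric] by (simp add: power_mult_distrib mult_left_mono)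
        then show ?thesis by (simp flip: exp_add)
      qed
      ultimately have "norm (char M t - char G t) * exp (- \<epsilon>\<^sup>2 * t\<^sup>2 / 2) \<le> 2 * (exp (- l\<^sup>2 / 4) * exp (- \<epsilon>\<^sup>2 * t\<^sup>2 / 4))"
        by (intro mult_mono) auto
      \<comment> \<open>Outside the window \<open>\<bar>t\<bar> / T\<close> exceeds 1; inserting it
        produces the factor \<open>\<bar>t\<bar>\<close> that the inversion bound requires.\<close>
      also have "\<dots> \<le> (\<bar>t\<bar> / T) * (2 * (exp (- l\<^sup>2 / 4) * exp (- \<epsilon>\<^sup>2 * t\<^sup>2 / 4)))"
        using False pos by (intro mult_right_mono[of 1 "\<bar>t\<bar> / T", simplified mult_1]) (auto simp: field_simps)
      also have "\<dots> = \<bar>t\<bar> * (2 / T * exp (- l\<^sup>2 / 4) * exp (- \<epsilon>\<^sup>2 * t\<^sup>2 / 4))" by simp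
      also have "\<dots> \<le> \<bar>t\<bar> * g t" unfolding g_def using pos B by (intro mult_left_mono) auto
      finally show ?thesis unfolding e .
    qed
  qed
  have sq: "sqrt (2 * pi) \<le> pi"
    using pi_ge_two by (intro real_le_lsqrt) (auto simp: power2_eq_square)
  define I where "I = B * L * (sqrt (2 * pi) * 4 ^ 3) + 2 / T * exp (- l\<^sup>2 / 4) * (sqrt (2 * pi) * (sqrt 2 / \<epsilon>))"
  have g_int: "has_bochner_integral lborel g I"
  proof -
    have "has_bochner_integral lborel (\<lambda>t. exp (- \<epsilon>\<^sup>2 * t\<^sup>2 / 4)) (sqrt (2 * pi) * (sqrt 2 / \<epsilon>))"
      using has_bochner_integral_gauss(1)[of "sqrt 2 / \<epsilon>"] pos by (simp add: power_divide mult_ac)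
    moreover have "has_bochner_integral lborel (\<lambda>t. t\<^sup>2 * exp (- t\<^sup>2 / 32)) (sqrt (2 * pi) * 4 ^ 3)"
      using has_bochner_integral_gauss(2)[of 4] by simp
    ultimately show ?thesis unfolding g_def I_def
      by (intro has_bochner_integral_add has_bochner_integral_mult_right)
  qed
  have I: "I / pi \<le> 64 * B * L + 8 * exp (- l\<^sup>2 / 4)"
  proof -
    have "sqrt 2 \<le> 2" using real_sqrt_le_iff[of 2 4] by simp
    then have "sqrt 2 / l \<le> 2" using l by (simp add: field_simps)
    have "I = 64 * B * L * sqrt (2 * pi) + 2 * exp (- l\<^sup>2 / 4) * sqrt (2 * pi) * (sqrt 2 / l)"
      unfolding I_def pos(4)[symmetric] by (simp add: mult_ac)
    also have "\<dots> \<le> 64 * B * L * pi + 2 * exp (- l\<^sup>2 / 4) * pi * 2"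
      using sq \<open>sqrt 2 / l \<le> 2\<close> pos B l by (intro add_mono mult_mono) auto
    also have "\<dots> \<le> (64 * B * L + 8 * exp (- l\<^sup>2 / 4)) * pi" by (simp add: algebra_simps)
    finally show ?thesis by (simp add: field_simps)
  qed
  have D: "\<bar>cdf (M \<star> N) y - cdf (G \<star> N) y\<bar> \<le> 64 * B * L + 8 * exp (- l\<^sup>2 / 4)" for y
  proof -
    have "\<bar>cdf (M \<star> N) y - cdf (G \<star> N) y\<bar> \<le> (LBINT t. g t) / pi"
      by (rule cdf_diff_le_char[OF real_distribution_convolution[OF M N] real_distribution_convolution[OF G N] _ _ bound])
        (use g_int pos B in \<open>auto simp: g_def[abs_def] has_bochner_integral_iff\<close>)
    also have "(LBINT t. g t) = I" using g_int by (simp add: has_bochner_integral_iff)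
    finally show ?thesis using I by linarith
  qed
  have cdfG: "cdf G y = cdf std_normal_distribution (y / s)" for y
    unfolding G_def by (rule cdf_distr_mult[OF real_dist_normal_dist]) (use s in simp)
  \<comment> \<open>Smoothing with shift \<open>\<epsilon> * l\<close>, that is, \<open>l\<close>
    standard deviations of \<open>N\<close>, so that each tail is a standard normal tail at
    \<open>l\<close>.\<close>
  have "\<bar>cdf M x - cdf G x\<bar> \<le> 64 * B * L + 8 * exp (- l\<^sup>2 / 4) + 2 * 3 * (\<epsilon> * l) + 2 * (2 * exp (- l\<^sup>2 / 4))"
  proof (rule cdf_diff_le_smoothing[OF M G N _ D])
    show "cdf G v - cdf G u \<le> 3 * (v - u)" if "u \<le> v" for u v
    proof -
      have "cdf G v - cdf G u \<le> v / s - u / s"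
        unfolding cdfG by (rule cdf_std_normal_lipschitz) (use s that in \<open>simp add: divide_right_mono\<close>)
      also have "\<dots> = (v - u) * (1 / s)" by (simp add: diff_divide_distrib)
      also have "\<dots> \<le> (v - u) * 3" using s that by (intro mult_left_mono) (auto simp: field_simps)
      finally show ?thesis by simp
    qed
    have "measure N A = measure std_normal_distribution ((\<lambda>z. \<epsilon> * z) -` A)" if "A \<in> sets borel" for A
      unfolding N_def by (subst measure_distr) (use that in auto)
    moreover have "measure std_normal_distribution ((\<lambda>z. \<epsilon> * z) -` {\<epsilon> * l<..}) \<le> 2 * exp (- l\<^sup>2 / 4)"
      "measure std_normal_distribution ((\<lambda>z. \<epsilon> * z) -` {..<- (\<epsilon> * l)}) \<le> 2 * exp (- l\<^sup>2 / 4)"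
    proof -
      have 1: "(\<lambda>z. \<epsilon> * z) -` {\<epsilon> * l<..} = {l<..}" using pos by auto
      have "- (\<epsilon> * l) = \<epsilon> * (- l)" by simp
      then have 2: "(\<lambda>z. \<epsilon> * z) -` {..<- (\<epsilon> * l)} = {..<-l}" using pos
        using mult_less_cancel_left_pos[of \<epsilon> _ "- l"] by auto
      show "measure std_normal_distribution ((\<lambda>z. \<epsilon> * z) -` {\<epsilon> * l<..}) \<le> 2 * exp (- l\<^sup>2 / 4)"
        "measure std_normal_distribution ((\<lambda>z. \<epsilon> * z) -` {..<- (\<epsilon> * l)}) \<le> 2 * exp (- l\<^sup>2 / 4)"
        unfolding 1 2 by (rule std_normal_tail_le; use l in auto)+
    qed
    ultimately show "measure N {\<epsilon> * l<..} \<le> 2 * exp (- l\<^sup>2 / 4)" "measure N {..<- (\<epsilon> * l)} \<le> 2 * exp (- l\<^sup>2 / 4)"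
      by simp_all
  qed (use pos l in auto)
  also have "\<dots> = 64 * B * L + 12 * exp (- l\<^sup>2 / 4) + 24 * B * (a * l\<^sup>2)"
    by (simp add: \<epsilon>_def power2_eq_square)
  also have "\<dots> \<le> 64 * B * L + 64 * B * exp (- l\<^sup>2 / 4) + 64 * B * (a * l\<^sup>2)"
    using B a l pos by (intro add_mono mult_right_mono) auto
  finally show ?thesis unfolding cdfG s_def L_def by (simp add: algebra_simps)
qed

section \<open>Differences of sample means\<close>

text \<open>The mean cancels, and with the block sums \<open>S\<close> and \<open>S'\<close> the
  difference is \<open>\<sigma> * (N * S' - k * S) / (N * (N + k))\<close>. The scale factor is
  chosen so that, for standardized independent summands, the new block has variance 1 and the old
  one variance \<open>k / N\<close>.\<close>

lemma delta_plus_eq_standardized: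
  fixes Z :: "nat \<Rightarrow> 'a \<Rightarrow> real"
  assumes N: "N > 0" and k: "k > 0" and X: "\<And>i. i \<ge> 1 \<Longrightarrow> X i \<omega> = m + \<sigma> * Z i \<omega>"
  shows "delta_plus X N k \<omega> = \<sigma> * sqrt (real k) / real (N + k) *
    (\<Sum>i = 1..N + k. (if i \<le> N then - (sqrt (real k) / real N) else 1 / sqrt (real k)) * Z i \<omega>)"
proof -
  define S where "S = (\<Sum>i = 1..N. Z i \<omega>)"
  define S' where "S' = (\<Sum>i = N + 1..N + k. Z i \<omega>)"
  define q where "q = sqrt (real k)"
  have q: "q > 0" "real k = q * q" using k by (auto simp: q_def)
  have split: "(\<Sum>i = 1..N + k. f i) = (\<Sum>i = 1..N. f i) + (\<Sum>i = N + 1..N + k. f i)" for f :: "nat \<Rightarrow> real"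
    by (rule sum.ub_add_nat) simp
  have X1: "(\<Sum>i = 1..n. X i \<omega>) = real n * m + \<sigma> * (\<Sum>i = 1..n. Z i \<omega>)" for n
    by (simp add: X sum.distrib sum_distrib_left)
  have "(\<Sum>i = 1..N. (if i \<le> N then - (q / real N) else 1 / q) * Z i \<omega>) = - (q / real N) * S"
    unfolding S_def sum_distrib_left by (intro sum.cong) auto
  moreover have "(\<Sum>i = N + 1..N + k. (if i \<le> N then - (q / real N) else 1 / q) * Z i \<omega>) = 1 / q * S'"
    unfolding S'_def sum_distrib_left by (intro sum.cong) auto
  ultimately have W: "(\<Sum>i = 1..N + k. (if i \<le> N then - (q / real N) else 1 / q) * Z i \<omega>) = - (q / real N) * S + 1 / q * S'"
    unfolding split by simp
  have "delta_plus X N k \<omega> = \<sigma> * ((S + S') / real (N + k) - S / real N)"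
    unfolding delta_plus_def sample_mean_def X1 split S_def[symmetric] S'_def[symmetric]
    using N by (simp add: field_simps)
  also have "\<dots> = \<sigma> * q / real (N + k) * (- (q / real N) * S + 1 / q * S')"
  proof -
    define n r where "n = real N" and "r = real (N + k)"
    have r: "n > 0" "r > 0" "r = n + q * q" using N q by (auto simp: n_def r_def)
    have "(S + S') / r - S / n = (n * (S + S') - r * S) / (r * n)"
      using r(1,2) by (simp add: field_simps)
    also have "n * (S + S') - r * S = n * S' - q * q * S" unfolding r(3) by (simp add: algebra_simps)
    also have "(n * S' - q * q * S) / (r * n) = q / r * (- (q / n) * S + 1 / q * S')"
      using r(1,2) q(1) by (simp add: field_simps)
    finally have "(S + S') / real (N + k) - S / real N = q / real (N + k) * (- (q / real N) * S + 1 / q * S')"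
      unfolding n_def r_def .
    then show ?thesis by simp
  qed
  finally show ?thesis unfolding q_def[symmetric] W .
qed

text \<open>The weights have square sum \<open>(N + k) / N\<close>. Together with the scale factor
  this amounts to dividing \<open>z\<close> by \<open>\<sigma> * sqrt (k / (N * (N + k)))\<close>,
  the standard deviation of \<open>delta_plus\<close>.\<close>

lemma sqrt_scaling_eq:
  assumes "N > 0" "k > 0" "\<sigma> > 0"
  shows "z / (\<sigma> * sqrt (real k) / real (N + k)) / sqrt (real k * (1 / sqrt (real k))\<^sup>2 + real N * (sqrt (real k) / real N)\<^sup>2)
    = z * sqrt (real N * real (N + k) / real k) / \<sigma>"
proof -
  have "real k * (1 / sqrt (real k))\<^sup>2 + real N * (sqrt (real k) / real N)\<^sup>2 = real (N + k) / real N"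
    using assms by (simp add: power_divide field_simps power2_eq_square)
  moreover define A P Q where "A = sqrt (real (N + k))" and "P = sqrt (real N)" and "Q = sqrt (real k)"
  moreover have "sqrt (real (N + k) / real N) = A / P" "sqrt (real N * real (N + k) / real k) = P * A / Q"
    unfolding A_def P_def Q_def by (simp_all only: real_sqrt_divide real_sqrt_mult)
  moreover have "A > 0" "P > 0" "Q > 0" "real (N + k) = A * A" using assms by (simp_all add: A_def P_def Q_def)
  moreover have "z / (\<sigma> * Q / (A * A)) / (A / P) = z * (P * A / Q) / \<sigma>"
    using \<open>A > 0\<close> \<open>P > 0\<close> \<open>Q > 0\<close> assms by (simp add: field_simps)
  ultimately show ?thesis by metis
qed

text \<open>The two-block bound with weights \<open>a = 1 / sqrt k\<close> for the new variables and
  \<open>b = sqrt k / N\<close> for the old ones. \<open>C\<close> depends on none of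
  \<open>N\<close>, \<open>k\<close>, \<open>l\<close>, \<open>z\<close>, so the bound can be used
  at both \<open>n\<close> and \<open>n - k\<close>, uniformly in the argument.\<close>

lemma (in prob_space) F_plus_normal_approx:
  fixes X :: "nat \<Rightarrow> 'a \<Rightarrow> real"
  assumes indep: "indep_vars (\<lambda>_. borel) X {1..}"
    and ident: "\<And>i. i \<ge> 1 \<Longrightarrow> distr M borel (X i) = distr M borel (X 1)"
    and third_moment: "integrable M (\<lambda>\<omega>. \<bar>X 1 \<omega>\<bar> ^ 3)"
    and sigma: "\<sigma> > 0" "variance (X 1) = \<sigma>\<^sup>2"
  obtains C where "C \<ge> 0" and "\<And>N k l z. 2 \<le> k \<Longrightarrow> k \<le> N \<Longrightarrow> 1 \<le> l \<Longrightarrow>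
    \<bar>F_plus M X N k z - cdf std_normal_distribution (z * sqrt (real N * real (N + k) / real k) / \<sigma>)\<bar>
      \<le> C * (l\<^sup>2 / sqrt (real k) + exp (- l\<^sup>2 / 4))"
proof -
  define m where "m = expectation (X 1)"
  define h where "h x = (x - m) / \<sigma>" for x
  define Z where "Z i \<omega> = h (X i \<omega>)" for i \<omega>
  define \<mu> where "\<mu> = distr M borel (Z 1)"
  have [measurable]: "h \<in> borel_measurable borel" unfolding h_def[abs_def] by measurable
  have X_rv: "random_variable borel (X i)" if "i \<ge> 1" for i
    using indep that unfolding indep_vars_def2 by auto
  note [measurable] = X_rv[OF order_refl]
  have Z_rv: "random_variable borel (Z i)" if "i \<ge> 1" for i
    unfolding Z_def using X_rv[OF that] by measurable
  have distr_Z: "distr M borel (Z i) = \<mu>" if "i \<ge> 1" for i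
  proof -
    have "distr M borel (Z j) = distr (distr M borel (X j)) borel h" if "j \<ge> 1" for j
      using X_rv[OF that] by (subst distr_distr) (auto simp: Z_def[abs_def] comp_def)
    then show ?thesis unfolding \<mu>_def using ident[OF that] that by simp
  qed
  have \<mu>: "real_distribution \<mu>" unfolding \<mu>_def by (intro real_distribution_distr Z_rv) simp
  note mom = integrable_of_third_moment[OF X_rv[OF order_refl] third_moment]
  have "integral\<^sup>L \<mu> (\<lambda>x. x) = expectation (Z 1)"
    unfolding \<mu>_def by (subst integral_distr) (auto intro: Z_rv)
  also have "\<dots> = 0" using mom(1) unfolding Z_def h_def by (simp add: m_def prob_space)
  finally have mean: "integral\<^sup>L \<mu> (\<lambda>x. x) = 0" .
  have "integral\<^sup>L \<mu> (\<lambda>x. x\<^sup>2) = expectation (\<lambda>\<omega>. (Z 1 \<omega>)\<^sup>2)"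
    unfolding \<mu>_def by (subst integral_distr) (auto intro: Z_rv)
  also have "\<dots> = variance (X 1) / \<sigma>\<^sup>2" unfolding Z_def h_def m_def by (simp add: power_divide)
  finally have var: "integral\<^sup>L \<mu> (\<lambda>x. x\<^sup>2) = 1" using sigma by simp
  have third: "integrable \<mu> (\<lambda>x. \<bar>x\<bar> ^ 3)"
    unfolding \<mu>_def using mom(3)[of m \<sigma>] Z_rv[of 1]
    by (subst integrable_distr_eq) (auto simp: Z_def h_def)
  obtain B where B: "B \<ge> 1" "\<And>u. norm (char \<mu> u - exp (- u\<^sup>2 / 2)) \<le> B * \<bar>u\<bar> ^ 3"
    "\<And>u. B * \<bar>u\<bar> \<le> 1 / 4 \<Longrightarrow> norm (char \<mu> u) \<le> exp (- u\<^sup>2 / 4)"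
    using real_distribution.char_gaussian_approx[OF \<mu> mean var third] by blast
  show ?thesis
  proof (rule that[of "192 * B"])
    show "192 * B \<ge> 0" using B by simp
    fix N k :: nat and l z :: real
    assume k: "2 \<le> k" "k \<le> N" and l: "1 \<le> l"
    define a where "a = 1 / sqrt (real k)"
    define b where "b = sqrt (real k) / real N"
    define c where "c i = (if i \<le> N then - b else a)" for i
    define W where "W \<omega> = (\<Sum>i = 1..N + k. c i * Z i \<omega>)" for \<omega>
    define d where "d = \<sigma> * sqrt (real k) / real (N + k)"
    have pos: "a > 0" "b > 0" "d > 0" using k sigma by (auto simp: a_def b_def d_def)
    have W_rv: "random_variable borel W"
      unfolding W_def by (intro borel_measurable_sum borel_measurable_times borel_measurable_const Z_rv) auto
    have "delta_plus X N k = (\<lambda>\<omega>. d * W \<omega>)"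
    proof
      fix \<omega>
      show "delta_plus X N k \<omega> = d * W \<omega>"
        unfolding d_def W_def c_def a_def b_def
        by (rule delta_plus_eq_standardized) (use k sigma in \<open>auto simp: Z_def h_def\<close>)
    qed
    then have "distr M borel (delta_plus X N k) = distr (distr M borel W) borel (\<lambda>x. d * x)"
      using W_rv by (subst distr_distr) (auto simp: comp_def)
    then have F: "F_plus M X N k z = cdf (distr M borel W) (z / d)"
      unfolding F_plus_def using W_rv pos by (simp add: cdf_distr_mult real_distribution_distr)
    have char_W: "char (distr M borel W) t = char \<mu> (a * t) ^ k * char \<mu> (- b * t) ^ N" for t
    proof -
      have "indep_vars (\<lambda>_. borel) (\<lambda>i \<omega>. c i * h (X i \<omega>)) {1..N + k}"
        by (rule indep_vars_compose2[OF indep_vars_subset[OF indep]]) auto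
      then have "char (distr M borel W) t = (\<Prod>i = 1..N + k. char (distr M borel (\<lambda>\<omega>. c i * Z i \<omega>)) t)"
        unfolding W_def Z_def by (rule char_distr_sum)
      also have "\<dots> = (\<Prod>i = 1..N + k. char \<mu> (c i * t))"
      proof (rule prod.cong[OF refl])
        fix i assume "i \<in> {1..N + k}"
        then have i: "i \<ge> 1" by simp
        have "distr M borel (\<lambda>\<omega>. c i * Z i \<omega>) = distr (distr M borel (Z i)) borel (\<lambda>x. c i * x)"
          using Z_rv[OF i] by (subst distr_distr) (auto simp: comp_def)
        then show "char (distr M borel (\<lambda>\<omega>. c i * Z i \<omega>)) t = char \<mu> (c i * t)"
          by (simp add: distr_Z[OF i] char_distr_mult[OF \<mu>])
      qed
      also have "\<dots> = (\<Prod>i = 1..N. char \<mu> (c i * t)) * (\<Prod>i = N + 1..N + k. char \<mu> (c i * t))"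
        by (rule prod.ub_add_nat) simp
      also have "(\<Prod>i = 1..N. char \<mu> (c i * t)) = (\<Prod>i = 1..N. char \<mu> (- b * t))"
        by (intro prod.cong) (auto simp: c_def)
      also have "(\<Prod>i = N + 1..N + k. char \<mu> (c i * t)) = (\<Prod>i = N + 1..N + k. char \<mu> (a * t))"
        by (intro prod.cong) (auto simp: c_def)
      finally show ?thesis by simp
    qed
    have a2: "a\<^sup>2 = 1 / real k" using k by (simp add: a_def power_divide)
    \<comment> \<open>Here \<open>k \<ge> 2\<close> enters: the right side is
      \<open>1 - 1 / k\<close>.\<close>
    have ka: "1 / 8 \<le> (real k - 1) * a\<^sup>2" unfolding a2 using k by (simp add: field_simps)
    have "\<bar>cdf (distr M borel W) (z / d) - cdf std_normal_distribution (z / d / sqrt (real k * a\<^sup>2 + real N * b\<^sup>2))\<bar>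
        \<le> 64 * B * (real k * a ^ 3 + real N * b ^ 3 + a * l\<^sup>2 + exp (- l\<^sup>2 / 4))"
      by (rule berry_esseen_two_blocks[OF \<mu> real_distribution_distr[OF W_rv] B(1,2,3) char_W])
        (use pos ka l in auto)
    also have "\<dots> \<le> 64 * B * (3 * (l\<^sup>2 / sqrt (real k)) + 3 * exp (- l\<^sup>2 / 4))"
    proof -
      have "real k * a ^ 3 = a" using k a2 by (simp add: power3_eq_cube power2_eq_square)
      \<comment> \<open>Both \<open>N * b\<close> and \<open>k * a\<close> equal
        \<open>sqrt k\<close>, and \<open>b \<le> a\<close> since \<open>k \<le> N\<close>; so the
        old block contributes no more than the new one.\<close>
      moreover have "real N * b ^ 3 \<le> a"
      proof -
        have "b \<le> a" unfolding a_def b_def using k by (simp add: field_simps)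
        have "real N * b = real k * a" unfolding a_def b_def using k by (simp add: real_div_sqrt)
        then have "real N * b ^ 3 = real k * a * b\<^sup>2" by (simp add: power3_eq_cube power2_eq_square)
        also have "\<dots> \<le> real k * a * a\<^sup>2" using \<open>b \<le> a\<close> pos by (intro mult_left_mono power_mono) auto
        finally show ?thesis using k a2 by simp
      qed
      moreover have "a * 1 \<le> a * l\<^sup>2" using l pos by (intro mult_left_mono) auto
      moreover have "a * l\<^sup>2 = l\<^sup>2 / sqrt (real k)" by (simp add: a_def)
      moreover have "exp (- l\<^sup>2 / 4) > 0" by simp
      ultimately have "real k * a ^ 3 + real N * b ^ 3 + a * l\<^sup>2 + exp (- l\<^sup>2 / 4)
          \<le> 3 * (l\<^sup>2 / sqrt (real k)) + 3 * exp (- l\<^sup>2 / 4)" by linarith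
      then show ?thesis using B(1) by (intro mult_left_mono) auto
    qed
    also have "\<dots> = 192 * B * (l\<^sup>2 / sqrt (real k) + exp (- l\<^sup>2 / 4))" by (simp add: algebra_simps)
    also have "z / d / sqrt (real k * a\<^sup>2 + real N * b\<^sup>2) = z * sqrt (real N * real (N + k) / real k) / \<sigma>"
      unfolding a_def b_def d_def by (rule sqrt_scaling_eq) (use k sigma in auto)
    finally show "\<bar>F_plus M X N k z - cdf std_normal_distribution (z * sqrt (real N * real (N + k) / real k) / \<sigma>)\<bar>
      \<le> 192 * B * (l\<^sup>2 / sqrt (real k) + exp (- l\<^sup>2 / 4))" unfolding F .
  qed
qed

text \<open>Zero variance makes the variable almost surely constant, which is the lattice case of
  span 0. For a non-lattice variable this yields a positive \<sigma>.\<close>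

lemma (in prob_space) variance_zero_imp_lattice:
  fixes X :: "'a \<Rightarrow> real"
  assumes [measurable]: "random_variable borel X" and "integrable M X" "integrable M (\<lambda>\<omega>. (X \<omega>)\<^sup>2)" "variance X = 0"
  shows "\<P>(\<omega> in M. X \<omega> \<in> range (\<lambda>m :: int. expectation X + 0 * real_of_int m)) = 1"
proof -
  have "integrable M (\<lambda>\<omega>. (X \<omega> - expectation X)\<^sup>2)"
    using assms by (simp add: power2_diff)
  then have "AE \<omega> in M. (X \<omega> - expectation X)\<^sup>2 = 0"
    using integral_nonneg_eq_0_iff_AE[of M "\<lambda>\<omega>. (X \<omega> - expectation X)\<^sup>2"] assms by simp
  then have "AE \<omega> in M. X \<omega> = expectation X" by eventually_elim simp
  then have "\<P>(\<omega> in M. X \<omega> = expectation X) = 1" by (subst prob_Collect_eq_1) auto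
  moreover have "range (\<lambda>m :: int. expectation X + 0 * real_of_int m) = {expectation X}" by auto
  ultimately show ?thesis by simp
qed

section \<open>Asymptotics\<close>

lemma limits_of_powr_asymp:
  fixes k :: "nat \<Rightarrow> nat" and \<alpha> :: real
  assumes alpha: "0 < \<alpha>" "\<alpha> < 1"
    and k_asymp: "(\<lambda>n. real (k n) / real n powr \<alpha>) \<longlonglongrightarrow> 1"
  shows "(\<lambda>n. real (k n) / real n) \<longlonglongrightarrow> 0" and "filterlim (\<lambda>n. real (k n)) at_top sequentially"
proof -
  have p: "(\<lambda>n. real n powr \<alpha> / real n) \<longlonglongrightarrow> 0" using alpha by real_asymp
  have l: "(\<lambda>n. real (k n) / real n powr \<alpha> * (real n powr \<alpha> / real n)) \<longlonglongrightarrow> 1 * 0"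
    by (intro tendsto_mult k_asymp p)
  have "\<forall>\<^sub>F n in sequentially. real (k n) / real n powr \<alpha> * (real n powr \<alpha> / real n) = real (k n) / real n"
    using eventually_gt_at_top[of 0] by eventually_elim simp
  from Lim_transform_eventually[OF l this] show "(\<lambda>n. real (k n) / real n) \<longlonglongrightarrow> 0" by simp
  have q: "filterlim (\<lambda>n. real n powr \<alpha>) at_top sequentially" using alpha by real_asymp
  have "filterlim (\<lambda>n. real (k n) / real n powr \<alpha> * real n powr \<alpha>) at_top sequentially"
    by (rule filterlim_tendsto_pos_mult_at_top[OF k_asymp _ q]) simp
  moreover have "\<forall>\<^sub>F n in sequentially. real (k n) / real n powr \<alpha> * real n powr \<alpha> = real (k n)"
    using eventually_gt_at_top[of 0] by eventually_elim simp
  ultimately show "filterlim (\<lambda>n. real (k n)) at_top sequentially"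
    by (rule filterlim_mono_eventually[OF _ order_refl order_refl])
qed

text \<open>Divided by \<open>k / n\<close>, the first term is of order
  \<open>(ln n)\<^sup>2 * n powr (1 - 3 / 2 * \<alpha>)\<close>, where the exponent is negative
  because \<alpha> exceeds 2/3. The second decays faster than any power of \<open>n\<close>, and the
  third becomes a multiple of \<open>k / n\<close>.\<close>

lemma remainder_smallo:
  fixes k :: "nat \<Rightarrow> nat" and \<alpha> C D :: real
  assumes alpha: "2 / 3 < \<alpha>" "\<alpha> < 1"
    and k_asymp: "(\<lambda>n. real (k n) / real n powr \<alpha>) \<longlonglongrightarrow> 1"
  shows "(\<lambda>n. C * ((ln (real n))\<^sup>2 / sqrt (real (k n)) + exp (- (ln (real n))\<^sup>2 / 4)) + D * (real (k n) / real n)\<^sup>2)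
    \<in> o[sequentially](\<lambda>n. real (k n) / real n)"
proof (rule smalloI_tendsto)
  note lim0 = limits_of_powr_asymp[OF _ alpha(2) k_asymp]
  have lims: "(\<lambda>n. real (k n) / real n) \<longlonglongrightarrow> 0" "filterlim (\<lambda>n. real (k n)) at_top sequentially"
    using lim0 alpha by auto
  have ev: "\<forall>\<^sub>F n in sequentially. real (k n) \<ge> 1" using lims(2) unfolding filterlim_at_top by blast
  define r where "r n = real (k n) / real n powr \<alpha>" for n
  have r: "r \<longlonglongrightarrow> 1" using k_asymp by (simp add: r_def[abs_def])
  have "(\<lambda>n. (ln (real n))\<^sup>2 * real n powr (1 - 3 / 2 * \<alpha>)) \<longlonglongrightarrow> 0" using alpha by real_asymp
  \<comment> \<open>The denominator is the quotient of \<open>k powr (3 / 2)\<close> by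
    \<open>n powr (3 / 2 * \<alpha>)\<close>; it corrects for \<open>k\<close> being only asymptotic
    to the power of \<open>n\<close>.\<close>
  then have l: "(\<lambda>n. (ln (real n))\<^sup>2 * real n powr (1 - 3 / 2 * \<alpha>) / (r n * sqrt (r n))) \<longlonglongrightarrow> 0 / (1 * sqrt 1)"
    by (intro tendsto_divide tendsto_mult tendsto_real_sqrt r) auto
  have "\<forall>\<^sub>F n in sequentially. (ln (real n))\<^sup>2 * real n powr (1 - 3 / 2 * \<alpha>) / (r n * sqrt (r n))
      = (ln (real n))\<^sup>2 / sqrt (real (k n)) / (real (k n) / real n)"
    using eventually_gt_at_top[of 0] ev
  proof eventually_elim
    case (elim n)
    have pw: "real n powr (1 - 3 / 2 * \<alpha>) = real n / (real n powr \<alpha> * sqrt (real n powr \<alpha>))"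
    proof -
      have "sqrt (real n powr \<alpha>) = real n powr (\<alpha> / 2)" by (simp add: powr_half_sqrt_powr)
      then show ?thesis using elim by (simp add: powr_diff flip: powr_add)
    qed
    show ?case unfolding pw r_def using elim by (simp add: real_sqrt_divide)
  qed
  from Lim_transform_eventually[OF l this]
  have A: "(\<lambda>n. (ln (real n))\<^sup>2 / sqrt (real (k n)) / (real (k n) / real n)) \<longlonglongrightarrow> 0" by simp
  have B: "(\<lambda>n. exp (- (ln (real n))\<^sup>2 / 4) / (real (k n) / real n)) \<longlonglongrightarrow> 0"
  proof (rule tendsto_sandwich[of "\<lambda>_. 0"])
    show "(\<lambda>n. exp (- (ln (real n))\<^sup>2 / 4) * real n) \<longlonglongrightarrow> 0" by real_asymp
    show "\<forall>\<^sub>F n in sequentially. exp (- (ln (real n))\<^sup>2 / 4) / (real (k n) / real n) \<le> exp (- (ln (real n))\<^sup>2 / 4) * real n"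
      using ev
    proof eventually_elim
      case (elim n)
      have "exp (- (ln (real n))\<^sup>2 / 4) * real n / real (k n) \<le> exp (- (ln (real n))\<^sup>2 / 4) * real n / 1"
        using elim by (intro divide_left_mono) auto
      then show ?case by simp
    qed
  qed auto
  have l: "(\<lambda>n. C * ((ln (real n))\<^sup>2 / sqrt (real (k n)) / (real (k n) / real n) + exp (- (ln (real n))\<^sup>2 / 4) / (real (k n) / real n))
      + D * (real (k n) / real n)) \<longlonglongrightarrow> C * (0 + 0) + D * 0"
    by (intro tendsto_intros A B lims(1))
  have id: "C * (u / y + v / y) + D * y = (C * (u + v) + D * y\<^sup>2) / y" if "y \<noteq> 0" for u v y :: real
    using that by (simp add: field_simps power2_eq_square)
  have ev2: "\<forall>\<^sub>F n in sequentially. real (k n) / real n \<noteq> 0"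
    using eventually_gt_at_top[of 0] ev by eventually_elim auto
  then have "\<forall>\<^sub>F n in sequentially. C * ((ln (real n))\<^sup>2 / sqrt (real (k n)) / (real (k n) / real n) + exp (- (ln (real n))\<^sup>2 / 4) / (real (k n) / real n))
      + D * (real (k n) / real n) = (C * ((ln (real n))\<^sup>2 / sqrt (real (k n)) + exp (- (ln (real n))\<^sup>2 / 4)) + D * (real (k n) / real n)\<^sup>2) / (real (k n) / real n)"
    by eventually_elim (rule id)
  from Lim_transform_eventually[OF l this]
  show "(\<lambda>n. (C * ((ln (real n))\<^sup>2 / sqrt (real (k n)) + exp (- (ln (real n))\<^sup>2 / 4)) + D * (real (k n) / real n)\<^sup>2) / (real (k n) / real n)) \<longlonglongrightarrow> 0"
    by simp
  show "\<forall>\<^sub>F n in sequentially. real (k n) / real n \<noteq> 0" by (rule ev2)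
qed

section \<open>Assembling the normal approximations and the remainder into the uniform
  expansion\<close>

theorem theorem3p2:
  fixes M :: "'a measure"
    and X :: "nat \<Rightarrow> 'a \<Rightarrow> real"
    and F :: "real \<Rightarrow> real"
    and \<sigma> \<alpha> :: real
    and k :: "nat \<Rightarrow> nat"
  assumes "prob_space M"
    and indep: "prob_space.indep_vars M (\<lambda>_. borel) X {1..}"
    and ident: "\<And>i. i \<ge> 1 \<Longrightarrow> distr M borel (X i) = distr M borel (X 1)"
    and F: "F = cdf (distr M borel (X 1))"
    and third_moment: "integrable M (\<lambda>\<omega>. \<bar>X 1 \<omega>\<bar> ^ 3)"
    and sigma: "\<sigma> \<ge> 0" "prob_space.variance M (X 1) = \<sigma>\<^sup>2"
    and discrete: "discrete_rv M (X 1)"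
    and non_lattice: "\<not> lattice_rv M (X 1)"
    and alpha: "2 / 3 < \<alpha>" "\<alpha> < 1"
    and k_pos: "\<And>n. n \<ge> 1 \<Longrightarrow> k n \<ge> 1"
    and k_asymp: "(\<lambda>n. real (k n) / real n powr \<alpha>) \<longlonglongrightarrow> 1"
  shows "(\<lambda>n. SUP x :: real.
            \<bar>F_plus M X n (k n) (sqrt (real (k n)) * \<sigma> * x / real n)
             - F_minus M X n (k n) (sqrt (real (k n)) * \<sigma> * x / real n)
             - x * exp (- x\<^sup>2 / 2) / sqrt (2 * pi) * (real (k n) / real n)\<bar>)
         \<in> o[sequentially](\<lambda>n. real (k n) / real n)"
proof -
  interpret prob_space M by fact
  have X_rv: "random_variable borel (X 1)"
    using indep unfolding indep_vars_def2 by auto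
  note mom = integrable_of_third_moment[OF X_rv third_moment]
  have "\<sigma> \<noteq> 0"
  proof
    assume "\<sigma> = 0"
    then have "variance (X 1) = 0" using sigma by simp
    from variance_zero_imp_lattice[OF X_rv mom(1,2) this] have "lattice_rv M (X 1)"
      unfolding lattice_rv_def by blast
    then show False using non_lattice by contradiction
  qed
  then have "\<sigma> > 0" using sigma by simp
  obtain C where C: "C \<ge> 0" "\<And>N k l z. 2 \<le> k \<Longrightarrow> k \<le> N \<Longrightarrow> 1 \<le> l \<Longrightarrow>
    \<bar>F_plus M X N k z - cdf std_normal_distribution (z * sqrt (real N * real (N + k) / real k) / \<sigma>)\<bar>
      \<le> C * (l\<^sup>2 / sqrt (real k) + exp (- l\<^sup>2 / 4))"
    using F_plus_normal_approx[OF indep ident third_moment \<open>\<sigma> > 0\<close> sigma(2)] by blast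
  define R where "R n x = \<bar>F_plus M X n (k n) (sqrt (real (k n)) * \<sigma> * x / real n)
             - F_minus M X n (k n) (sqrt (real (k n)) * \<sigma> * x / real n)
             - x * exp (- x\<^sup>2 / 2) / sqrt (2 * pi) * (real (k n) / real n)\<bar>" for n x
  \<comment> \<open>Two normal approximations with \<open>l = ln n\<close>, plus the quadratic error
    of the difference of normal distribution functions.\<close>
  define E where "E n = 2 * C * ((ln (real n))\<^sup>2 / sqrt (real (k n)) + exp (- (ln (real n))\<^sup>2 / 4))
      + 48 * (real (k n) / real n)\<^sup>2" for n
  \<comment> \<open>\<open>3 \<le> n\<close> gives \<open>ln n \<ge> 1\<close>;
    \<open>2 * k n \<le> n\<close> gives both \<open>r \<le> 1 / 2\<close> and
    \<open>k n \<le> n - k n\<close>, so the approximation also applies with \<open>n - k n\<close>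
    old variables.\<close>
  have bound: "R n x \<le> E n" if n: "3 \<le> n" "2 \<le> k n" "2 * k n \<le> n" for n x
  proof -
    define z where "z = sqrt (real (k n)) * \<sigma> * x / real n"
    define r where "r = real (k n) / real n"
    have r: "0 \<le> r" "r \<le> 1 / 2" using n by (auto simp: r_def field_simps)
    have "exp 1 \<le> real n" using exp_le n by linarith
    then have l: "1 \<le> ln (real n)" using n by (subst ln_ge_iff) auto
    \<comment> \<open>Used with \<open>y = n + k n\<close> and \<open>y = n - k n\<close>, giving
      the arguments \<open>x * sqrt (1 + r)\<close> and \<open>x * sqrt (1 - r)\<close>.\<close>
    have scale: "z * sqrt (real n * y / real (k n)) / \<sigma> = x * sqrt (y / real n)" if "y \<ge> 0" for y
    proof -
      define p q where "p = sqrt (real n)" and "q = sqrt (real (k n))"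
      have pq: "p > 0" "q > 0" "real n = p * p" using n by (auto simp: p_def q_def)
      have "sqrt (real n * y / real (k n)) = p * sqrt y / q" "sqrt (y / real n) = sqrt y / p"
        unfolding p_def q_def by (simp_all only: real_sqrt_mult real_sqrt_divide)
      moreover have "q * \<sigma> * x / (p * p) * (p * sqrt y / q) / \<sigma> = x * (sqrt y / p)"
        using pq(1,2) \<open>\<sigma> > 0\<close> by (simp add: field_simps)
      ultimately show ?thesis unfolding z_def q_def[symmetric] pq(3) by simp
    qed
    have "\<bar>F_plus M X n (k n) z - cdf std_normal_distribution (x * sqrt (1 + r))\<bar>
        \<le> C * ((ln (real n))\<^sup>2 / sqrt (real (k n)) + exp (- (ln (real n))\<^sup>2 / 4))"
    proof -
      have "real (n + k n) / real n = 1 + r" using n by (simp add: r_def field_simps)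
      then show ?thesis
        using C(2)[of "k n" n "ln (real n)" z] n l scale[of "real (n + k n)"] by simp
    qed
    moreover have "\<bar>F_minus M X n (k n) z - cdf std_normal_distribution (x * sqrt (1 - r))\<bar>
        \<le> C * ((ln (real n))\<^sup>2 / sqrt (real (k n)) + exp (- (ln (real n))\<^sup>2 / 4))"
    proof -
      have "delta_minus X n (k n) = delta_plus X (n - k n) (k n)"
        using n by (auto simp: delta_minus_def delta_plus_def)
      then have minus: "F_minus M X n (k n) z = F_plus M X (n - k n) (k n) z"
        by (simp add: F_minus_def F_plus_def)
      have r_eq: "real (n - k n) / real n = 1 - r" using n by (simp add: r_def field_simps of_nat_diff)
      have sum_eq: "real (n - k n) * real (n - k n + k n) = real n * real (n - k n)" using n by simp
      have eq: "z * sqrt (real (n - k n) * real (n - k n + k n) / real (k n)) / \<sigma> = x * sqrt (1 - r)"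
        unfolding sum_eq scale[OF of_nat_0_le_iff] r_eq ..
      have "k n \<le> n - k n" using n by linarith
      from C(2)[OF n(2) this l, of z] show ?thesis unfolding eq minus .
    qed
    moreover note cdf_std_normal_symmetric_difference[OF r, of x]
    ultimately show ?thesis
      unfolding R_def E_def z_def[symmetric] r_def[symmetric] mult.assoc[of 2 C] by linarith
  qed
  have lims: "(\<lambda>n. real (k n) / real n) \<longlonglongrightarrow> 0" "filterlim (\<lambda>n. real (k n)) at_top sequentially"
    using limits_of_powr_asymp[OF _ alpha(2) k_asymp] alpha by auto
  have "\<forall>\<^sub>F n in sequentially. real (k n) / real n < 1 / 2"
    using lims(1) by (rule order_tendstoD) simp
  moreover have "\<forall>\<^sub>F n in sequentially. real (k n) \<ge> 2"
    using lims(2) unfolding filterlim_at_top by blast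
  ultimately have "\<forall>\<^sub>F n in sequentially. norm (SUP x. R n x) \<le> 1 * norm (E n)"
    using eventually_ge_at_top[of 3]
  proof eventually_elim
    case (elim n)
    then have n: "3 \<le> n" "2 \<le> k n" "2 * k n \<le> n" by (auto simp: field_simps)
    \<comment> \<open>Only a conditional supremum is available, so \<open>bound\<close> also
      supplies boundedness above. The value at \<open>x = 0\<close> shows that the supremum is
      nonnegative, hence equal to its norm.\<close>
    have "0 \<le> R n 0" by (simp add: R_def)
    also have "R n 0 \<le> (SUP x. R n x)"
      by (rule cSUP_upper) (use bound[OF n] in \<open>auto intro!: bdd_aboveI2\<close>)
    finally have "0 \<le> (SUP x. R n x)" .
    moreover have "(SUP x. R n x) \<le> E n" by (rule cSUP_least) (use bound[OF n] in auto)
    ultimately show ?case by simp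
  qed
  then have "(\<lambda>n. SUP x. R n x) \<in> O(E)" by (rule bigoI)
  also have "E \<in> o(\<lambda>n. real (k n) / real n)"
    unfolding E_def[abs_def] by (rule remainder_smallo[OF alpha k_asymp])
  finally show ?thesis unfolding R_def[abs_def] .
qed

end
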